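(* Let $T,M,\tau=T/M$, the mesh size $h$ and the spaces $V_h,\mathring W_h, W_h$ be as in the context. For any mesh parameters $\tau$ and $h$ and any phase parameter $\varepsilon>0$, the fully discrete scheme is uniquely solvable: for every $m\in\{1,\dots,M\}$ and every given $\varphi_h^{m-1}\in V_h$ there is exactly one triple $(p_h^m,\mu_h^m,\varphi_h^m)\in \mathring W_h\times V_h\times V_h$ such that $$(\nabla p_h^m+\gamma\varphi_h^{m-1}\nabla\mu_h^m,\nabla q_h)=0\qquad\forall q_h\in W_h,$$ $$(d_t\varphi_h^m,\nu_h)+\varepsilon(\nabla\mu_h^m,\nabla\nu_h)+(\varphi_h^{m-1}[\nabla p_h^m+\gamma\varphi_h^{m-1}\nabla\mu_h^m],\nabla\nu_h)=0\qquad\forall\nu_h\in V_h,$$ $$(\mu_h^m,\psi_h)-\varepsilon(\nabla\varphi_h^m,\nabla\psi_h)-\frac1\varepsilon(f_h^m,\psi_h)=0\qquad\forall\psi_h\in V_h,$$ where $f_h^m:=(\varphi_h^m)^3-\varphi_h^{m-1}$ and $d_t\varphi_h^m:=(\varphi_h^m-\varphi_h^{m-1})/\tau$.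
   Context: Let $d\in\{2,3\}$, let $\Omega\subset\mathbb{R}^d$ be a bounded polygonal ($d=2$) or polyhedral ($d=3$) domain, and let $\gamma>0$, $T>0$. Let $M\ge1$ be an integer, $\tau:=T/M$ and $t_m:=m\tau$. Let $\mathcal T_h$ be a quasi-uniform triangulation of $\Omega$ (triangles if $d=2$, tetrahedra if $d=3$) of mesh size $h\in(0,1)$. For a nonnegative integer $r$, let $P_r(K)$ be the polynomials of degree at most $r$ on $K$ and $S_h^r:=\{v_h\in C^0(\overline\Omega): v_h|_K\in P_r(K)\ \forall K\in\mathcal T_h\}$. For fixed positive integers $r,\ell$ set $V_h:=S_h^r$, $W_h:=S_h^\ell$, and let $L^2_0(\Omega)$ be the subspace of functions in $L^2(\Omega)$ with zero mean, $\mathring V_h:=V_h\cap L^2_0(\Omega)$, $\mathring W_h:=W_h\cap L_0^2(\Omega)$. $(\cdot,\cdot)$ is the $L^2(\Omega)$ inner product. *)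

theory Defs
  imports "HOL-Analysis.Analysis"
begin

text \<open>
  A bounded polygonal (\<open>d = 2\<close>) or polyhedral (\<open>d = 3\<close>) domain is a nonempty bounded connected
  open set whose boundary consists of finitely many flat pieces of dimension \<open>d - 1\<close>
  (segments, respectively planar polygons).  No convexity is assumed.
\<close>
definition polytopal_domain :: "(real ^ 'n) set \<Rightarrow> bool" where
  "polytopal_domain \<Omega> \<longleftrightarrow>
     \<Omega> \<noteq> {} \<and> open \<Omega> \<and> connected \<Omega> \<and> bounded \<Omega> \<and>
     (\<exists>\<F>. finite \<F> \<and> (\<forall>F\<in>\<F>. polytope F \<and> aff_dim F = int CARD('n) - 1) \<and>
          frontier \<Omega> = \<Union>\<F>)"

text \<open>
  The predicate \<open>triangulation\<close> of the library is the conformity condition: the elements are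
  simplices and any two of them meet in a common (possibly empty) face.
\<close>
definition simplicial_mesh :: "(real ^ 'n) set \<Rightarrow> (real ^ 'n) set set \<Rightarrow> bool" where
  "simplicial_mesh \<Omega> \<T> \<longleftrightarrow>
     triangulation \<T> \<and> (\<forall>K\<in>\<T>. int CARD('n) simplex K) \<and> \<Union>\<T> = closure \<Omega>"

definition mesh_size :: "(real ^ 'n) set set \<Rightarrow> real" where
  "mesh_size \<T> = Max (diameter ` \<T>)"

text \<open>
  Quasi-uniformity with constant \<open>\<rho>\<close>: every element contains a ball whose diameter is at least
  \<open>\<rho>\<close> times the mesh size.  A family of meshes is quasi-uniform if one \<open>\<rho> > 0\<close> serves all its members.
\<close>
definition quasi_uniform :: "real \<Rightarrow> (real ^ 'n) set set \<Rightarrow> bool" where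
  "quasi_uniform \<rho> \<T> \<longleftrightarrow> (\<forall>K\<in>\<T>. \<exists>c s. 0 < s \<and> \<rho> * mesh_size \<T> \<le> 2 * s \<and> cball c s \<subseteq> K)"

text \<open>Membership of \<open>v\<close> restricted to \<open>K\<close> in \<open>P\<^sub>r(K)\<close>; the sum runs over multi-indices.\<close>
definition is_poly_on :: "nat \<Rightarrow> (real ^ 'n) set \<Rightarrow> (real ^ 'n \<Rightarrow> real) \<Rightarrow> bool" where
  "is_poly_on r K v \<longleftrightarrow>
     (\<exists>a :: ('n \<Rightarrow> nat) \<Rightarrow> real. \<forall>x\<in>K.
        v x = (\<Sum>\<alpha> | (\<Sum>i\<in>UNIV. \<alpha> i) \<le> r. a \<alpha> * (\<Prod>i\<in>UNIV. (x $ i) ^ \<alpha> i)))"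

text \<open>
  A function on \<open>closure \<Omega>\<close> is represented by its extension by \<open>0\<close>, so that equality of
  representatives is equality on \<open>closure \<Omega>\<close>.
\<close>
definition fe_space :: "(real ^ 'n) set \<Rightarrow> (real ^ 'n) set set \<Rightarrow> nat \<Rightarrow> (real ^ 'n \<Rightarrow> real) set" where
  "fe_space \<Omega> \<T> r =
     {v. continuous_on (closure \<Omega>) v \<and> (\<forall>K\<in>\<T>. is_poly_on r K v) \<and> (\<forall>x. x \<notin> closure \<Omega> \<longrightarrow> v x = 0)}"

definition L2_zero_mean :: "(real ^ 'n) set \<Rightarrow> (real ^ 'n \<Rightarrow> real) set" where
  "L2_zero_mean \<Omega> =
     {v. set_borel_measurable lebesgue \<Omega> v \<and> set_integrable lebesgue \<Omega> (\<lambda>x. (v x)\<^sup>2) \<and>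
         (LINT x:\<Omega>|lebesgue. v x) = 0}"

definition L2_inner :: "(real ^ 'n) set \<Rightarrow> (real ^ 'n \<Rightarrow> 'b::real_inner) \<Rightarrow> (real ^ 'n \<Rightarrow> 'b) \<Rightarrow> real" where
  "L2_inner \<Omega> F G = (LINT x:\<Omega>|lebesgue. F x \<bullet> G x)"

text \<open>
  A continuous piecewise polynomial is classically differentiable in the interior of each element,
  that is, outside a null set, and its weak gradient is given almost everywhere by the classical one.
  At the remaining points the value below is unspecified, which does not affect integrals.
\<close>
definition grad :: "(real ^ 'n \<Rightarrow> real) \<Rightarrow> real ^ 'n \<Rightarrow> real ^ 'n" where
  "grad u x = (THE D. GDERIV u x :> D)"

text \<open>
  One time step of the scheme: \<open>\<phi>\<^sub>0\<close> is the given phase field of the previous time level and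
  \<open>(p, \<mu>, \<phi>)\<close> is the new pressure, chemical potential and phase field.
\<close>
definition scheme_step ::
  "(real ^ 'n) set \<Rightarrow> (real ^ 'n \<Rightarrow> real) set \<Rightarrow> (real ^ 'n \<Rightarrow> real) set \<Rightarrow> real \<Rightarrow> real \<Rightarrow> real \<Rightarrow>
   (real ^ 'n \<Rightarrow> real) \<Rightarrow> (real ^ 'n \<Rightarrow> real) \<Rightarrow> (real ^ 'n \<Rightarrow> real) \<Rightarrow> (real ^ 'n \<Rightarrow> real) \<Rightarrow> bool" where
  "scheme_step \<Omega> V W \<gamma> \<epsilon> \<tau> \<phi>\<^sub>0 p \<mu> \<phi> \<longleftrightarrow>
     (\<forall>q\<in>W. L2_inner \<Omega> (\<lambda>x. grad p x + (\<gamma> * \<phi>\<^sub>0 x) *\<^sub>R grad \<mu> x) (grad q) = 0) \<and>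
     (\<forall>\<nu>\<in>V. L2_inner \<Omega> (\<lambda>x. (\<phi> x - \<phi>\<^sub>0 x) / \<tau>) \<nu>
            + \<epsilon> * L2_inner \<Omega> (grad \<mu>) (grad \<nu>)
            + L2_inner \<Omega> (\<lambda>x. \<phi>\<^sub>0 x *\<^sub>R (grad p x + (\<gamma> * \<phi>\<^sub>0 x) *\<^sub>R grad \<mu> x)) (grad \<nu>) = 0) \<and>
     (\<forall>\<psi>\<in>V. L2_inner \<Omega> \<mu> \<psi>
            - \<epsilon> * L2_inner \<Omega> (grad \<phi>) (grad \<psi>)
            - 1 / \<epsilon> * L2_inner \<Omega> (\<lambda>x. (\<phi> x) ^ 3 - \<phi>\<^sub>0 x) \<psi> = 0)"

end

theory Submission
  imports Defs "HOL-Library.Function_Algebras"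
begin

text \<open>
  The scheme is an implicit step of a gradient flow whose energy is strictly convex, whatever the
  parameters are; this is why no relation between time step, mesh size and \<open>\<epsilon>\<close> is required.

  First, the pressure can be eliminated.  For a given \<open>\<mu>\<close> the first equation is a discrete Neumann
  problem with exactly one solution of mean zero (\<open>pressure_exists_unique\<close>), which depends linearly
  on \<open>\<mu>\<close>.  The flux \<open>F \<mu> = grad p + \<gamma> \<phi>\<^sub>0 grad \<mu>\<close> is orthogonal to all discrete pressure gradients,
  so the convective term of the second equation equals \<open>(1 / \<gamma>) (F \<mu>, F \<nu>)\<close>.  The second equation
  thus becomes \<open>(\<phi> - \<phi>\<^sub>0, \<nu>) + \<tau> B(\<mu>, \<nu>) = 0\<close> with the symmetric nonnegative form
  \<open>B(\<mu>, \<nu>) = \<epsilon> (grad \<mu>, grad \<nu>) + (1 / \<gamma>) (F \<mu>, F \<nu>)\<close>, and the third says that \<open>\<mu>\<close> represents the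
  derivative at \<open>\<phi>\<close> of the energy
  \<open>\<epsilon> / 2 \<parallel>grad \<phi>\<parallel>\<^sup>2 + 1 / (4 \<epsilon>) \<integral> \<phi>\<^sup>4 - 1 / \<epsilon> (\<phi>\<^sub>0, \<phi>)\<close>.

  Systems of this shape are uniquely solvable in every finitely generated space
  (\<open>implicit_gradient_step\<close>): a solution arises from the minimiser of the energy plus a quadratic
  dissipation, expressed in coordinates of \<open>\<mu>\<close> with respect to a \<open>B\<close>-orthonormal set, and uniqueness
  follows from the nonnegativity of \<open>B\<close> and the strict monotonicity of the derivative of the energy.

  What the mesh has to provide is modest.  The open elements fill \<open>\<Omega>\<close> up to a null set, discrete
  functions are determined by their values there and have bounded continuous gradients there, a
  discrete function with zero gradient is constant because \<open>\<Omega>\<close> is connected, and finite element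
  spaces are finitely generated.
\<close>

section \<open>Semidefinite forms on finitely generated spaces\<close>

text \<open>
  The weighted gradient forms of the scheme degenerate on constants, so definiteness is not part of
  the interface.  All laws are relative to \<open>V\<close> because the integrals behind the forms obey them
  only on a space of integrable functions.
\<close>
locale semi_inner =
  fixes V :: "'v::real_vector set" and a :: "'v \<Rightarrow> 'v \<Rightarrow> real"
  assumes subspace_V: "subspace V"
    and sym: "u \<in> V \<Longrightarrow> v \<in> V \<Longrightarrow> a u v = a v u"
    and add_left: "u \<in> V \<Longrightarrow> v \<in> V \<Longrightarrow> w \<in> V \<Longrightarrow> a (u + v) w = a u w + a v w"
    and scale_left: "u \<in> V \<Longrightarrow> w \<in> V \<Longrightarrow> a (c *\<^sub>R u) w = c * a u w"
    and nonneg: "u \<in> V \<Longrightarrow> 0 \<le> a u u"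
begin

lemmas V_closed = subspace_0[OF subspace_V] subspace_add[OF subspace_V]
  subspace_diff[OF subspace_V] subspace_scale[OF subspace_V] subspace_sum[OF subspace_V]

lemma zero_left: "w \<in> V \<Longrightarrow> a 0 w = 0"
  using scale_left[of 0 w 0] V_closed by simp

lemma diff_left: "u \<in> V \<Longrightarrow> v \<in> V \<Longrightarrow> w \<in> V \<Longrightarrow> a (u - v) w = a u w - a v w"
  using add_left[of u "(-1) *\<^sub>R v" w] scale_left[of v w "-1"] V_closed(4)[of v "-1"] by simp

lemma sum_left:
  assumes "\<And>i. i \<in> I \<Longrightarrow> g i \<in> V" "w \<in> V"
  shows "a (\<Sum>i\<in>I. c i *\<^sub>R g i) w = (\<Sum>i\<in>I. c i * a (g i) w)"
  using assms(1)
proof (induction I rule: infinite_finite_induct)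
  case (insert i I)
  then have "a (\<Sum>j\<in>insert i I. c j *\<^sub>R g j) w = a (c i *\<^sub>R g i) w + a (\<Sum>j\<in>I. c j *\<^sub>R g j) w"
    using assms(2) by (simp add: add_left V_closed)
  then show ?case using insert assms(2) by (simp add: scale_left)
qed (auto simp: zero_left assms(2))

lemma add_right: "u \<in> V \<Longrightarrow> v \<in> V \<Longrightarrow> w \<in> V \<Longrightarrow> a w (u + v) = a w u + a w v"
  using add_left[of u v w] sym V_closed(2) by metis

lemma scale_right: "u \<in> V \<Longrightarrow> w \<in> V \<Longrightarrow> a w (c *\<^sub>R u) = c * a w u"
  using scale_left[of u w c] sym V_closed(4) by metis

text \<open>
  Otherwise \<open>a (v + t w) (v + t w)\<close> is affine in \<open>t\<close> with nonzero slope, and such a function cannot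
  stay nonnegative.  Hence a vector that \<open>a\<close> does not see in its own norm is invisible to \<open>a\<close>
  altogether.
\<close>
lemma null_orthogonal:
  assumes w: "w \<in> V" "a w w = 0" and v: "v \<in> V"
  shows "a w v = 0"
proof (rule ccontr)
  assume c: "a w v \<noteq> 0"
  \<comment> \<open>The value of \<open>t\<close> at which the affine function equals \<open>-1\<close>.\<close>
  define t where "t = - (a v v + 1) / (2 * a w v)"
  have "0 \<le> a (v + t *\<^sub>R w) (v + t *\<^sub>R w)"
    using w v by (intro nonneg V_closed)
  also have "\<dots> = a v v + 2 * t * a w v"
    using w v sym[of v w] by (simp add: add_left add_right scale_left scale_right V_closed)
  also have "\<dots> = -1"
    using c by (simp add: t_def field_simps)
  finally show False by simp
qed

lemma null_add:
  assumes "u \<in> V" "a u u = 0" "v \<in> V" "a v v = 0"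
  shows "a (u + v) (u + v) = 0"
  using assms null_orthogonal by (simp add: add_left add_right V_closed)

definition residual :: "'v set \<Rightarrow> 'v \<Rightarrow> 'v" where
  "residual E v = v - (\<Sum>e\<in>E. a v e *\<^sub>R e)"

lemma residual_in: "E \<subseteq> V \<Longrightarrow> v \<in> V \<Longrightarrow> residual E v \<in> V"
  unfolding residual_def by (intro V_closed) auto

lemma residual_add:
  assumes "E \<subseteq> V" "u \<in> V" "v \<in> V"
  shows "residual E (c *\<^sub>R u + v) = c *\<^sub>R residual E u + residual E v"
proof -
  have "(\<Sum>e\<in>E. a (c *\<^sub>R u + v) e *\<^sub>R e) = (\<Sum>e\<in>E. c *\<^sub>R (a u e *\<^sub>R e) + a v e *\<^sub>R e)"
    using assms by (intro sum.cong) (auto simp: add_left scale_left V_closed scaleR_add_left)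
  then show ?thesis
    unfolding residual_def by (simp add: sum.distrib scaleR_sum_right algebra_simps)
qed

definition orthonormal :: "'v set \<Rightarrow> bool" where
  "orthonormal E \<longleftrightarrow> E \<subseteq> V \<and> finite E \<and> (\<forall>e\<in>E. \<forall>f\<in>E. a e f = (if e = f then 1 else 0))"

lemma residual_orthogonal:
  assumes E: "orthonormal E" and v: "v \<in> V" and f: "f \<in> E"
  shows "a (residual E v) f = 0"
proof -
  have EV: "E \<subseteq> V" "finite E" using E by (auto simp: orthonormal_def)
  have "a (residual E v) f = a v f - (\<Sum>e\<in>E. a v e * a e f)"
    unfolding residual_def using EV v f by (subst diff_left) (auto intro!: V_closed simp: sum_left subset_eq)
  also have "(\<Sum>e\<in>E. a v e * a e f) = (\<Sum>e\<in>E. if e = f then a v e else 0)"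
    using E f by (intro sum.cong) (auto simp: orthonormal_def)
  also have "\<dots> = a v f" using EV f by simp
  finally show ?thesis by simp
qed

text \<open>
  Gram-Schmidt for a degenerate form: a generator whose residual is null is dropped, any other one
  contributes its normalised residual.  The resulting finite set spans \<open>span S\<close> up to null vectors,
  which by \<open>null_orthogonal\<close> is as good as spanning it.
\<close>
lemma orthonormal_modulo_kernel:
  assumes "finite S" "S \<subseteq> V"
  shows "\<exists>E. orthonormal E \<and> (\<forall>v\<in>span S. a (residual E v) (residual E v) = 0)"
  using assms
proof (induction S)
  case empty
  show ?case
    by (rule exI[of _ "{}"]) (auto simp: orthonormal_def residual_def zero_left V_closed)
next
  case (insert s S)
  then obtain E where E: "orthonormal E"
      and null: "\<And>v. v \<in> span S \<Longrightarrow> a (residual E v) (residual E v) = 0" by auto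
  have EV: "E \<subseteq> V" "finite E" using E by (auto simp: orthonormal_def)
  have sV: "s \<in> V" and SV: "span S \<subseteq> V"
    using insert.prems subspace_V by (auto simp: span_minimal)
  have breakdown: "\<exists>k. \<exists>v'\<in>span S. v = k *\<^sub>R s + v'" if "v \<in> span (insert s S)" for v
  proof -
    from that obtain k where "v - k *\<^sub>R s \<in> span S" by (auto simp: span_breakdown_eq)
    then show ?thesis by (intro exI[of _ k] bexI[of _ "v - k *\<^sub>R s"]) auto
  qed
  \<comment> \<open>It suffices that the new residuals of \<open>s\<close> and of the vectors of \<open>span S\<close> are null.\<close>
  have reduce: "a (residual F v) (residual F v) = 0"
    if v: "v \<in> span (insert s S)" and FV: "F \<subseteq> V" and s0: "a (residual F s) (residual F s) = 0"
      and S0: "\<And>v'. v' \<in> span S \<Longrightarrow> a (residual F v') (residual F v') = 0" for F v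
  proof -
    obtain k v' where v': "v' \<in> span S" "v = k *\<^sub>R s + v'" using breakdown[OF v] by blast
    then have "residual F v = k *\<^sub>R residual F s + residual F v'"
      using residual_add FV sV SV by blast
    moreover have "a (k *\<^sub>R residual F s) (k *\<^sub>R residual F s) = 0"
      using s0 residual_in[OF FV sV] by (simp add: scale_left scale_right V_closed)
    moreover have "a (residual F v') (residual F v') = 0" using S0 v'(1) .
    moreover have "k *\<^sub>R residual F s \<in> V" "residual F v' \<in> V"
      using residual_in[OF FV] sV SV v'(1) by (auto intro!: V_closed)
    ultimately show ?thesis using null_add by metis
  qed
  define w where "w = residual E s"
  have wV: "w \<in> V" unfolding w_def using residual_in EV sV by blast
  show ?case
  proof (cases "a w w = 0")
    case True
    then show ?thesis using E null reduce[of _ E] EV unfolding w_def by blast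
  next
    case False
    then have pos: "a w w > 0" using nonneg[OF wV] by simp
    define n where "n = (1 / sqrt (a w w)) *\<^sub>R w"
    have nV: "n \<in> V" unfolding n_def by (intro V_closed wV)
    have nn: "a n n = 1"
      unfolding n_def using wV pos by (simp add: scale_left scale_right V_closed)
    have nE: "a n e = 0" "a e n = 0" if "e \<in> E" for e
    proof -
      show "a n e = 0"
        unfolding n_def using that EV wV residual_orthogonal[OF E sV that]
        by (subst scale_left) (auto simp: w_def)
      then show "a e n = 0" using sym nV that EV by (metis subsetD)
    qed
    have nnotin: "n \<notin> E" using nE nn by force
    have on: "orthonormal (insert n E)"
      using E nV nn nE nnotin unfolding orthonormal_def by auto
    have res: "residual (insert n E) v = residual E v - a v n *\<^sub>R n" for v
      unfolding residual_def using nnotin EV by (simp add: algebra_simps)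
    have an: "a v n = a (residual E v) n" if "v \<in> V" for v
    proof -
      have "a (\<Sum>e\<in>E. a v e *\<^sub>R e) n = (\<Sum>e\<in>E. a v e * a e n)"
        using EV nV by (intro sum_left) auto
      also have "\<dots> = 0" using nE by simp
      finally have z: "a (\<Sum>e\<in>E. a v e *\<^sub>R e) n = 0" .
      have "a (residual E v) n = a v n - a (\<Sum>e\<in>E. a v e *\<^sub>R e) n"
        unfolding residual_def by (rule diff_left) (use that EV nV in \<open>auto intro!: V_closed\<close>)
      then show ?thesis using z by simp
    qed
    have "a s n = sqrt (a w w)"
      using an[OF sV] pos wV unfolding w_def[symmetric] n_def
      by (simp add: scale_right real_div_sqrt)
    then have "residual (insert n E) s = 0"
      unfolding res w_def[symmetric] using pos by (simp add: n_def)
    then have s0: "a (residual (insert n E) s) (residual (insert n E) s) = 0"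
      by (simp add: zero_left V_closed)
    have S0: "a (residual (insert n E) v) (residual (insert n E) v) = 0" if "v \<in> span S" for v
    proof -
      have vV: "v \<in> V" using that SV by blast
      have "a v n = 0"
        using null_orthogonal[OF residual_in[OF EV(1) vV] null[OF that] nV] an[OF vV] by simp
      then show ?thesis using null[OF that] by (simp add: res)
    qed
    show ?thesis
      using on reduce[of _ "insert n E"] s0 S0 EV nV by (intro exI[of _ "insert n E"]) auto
  qed
qed

text \<open>
  For a degenerate form the functional has to vanish on null vectors; the representer is then read
  off in an orthonormal set, \<open>u = (\<Sum>e. L e *\<^sub>R e)\<close>, and is unique only up to null vectors.
\<close>
lemma riesz_representation:
  assumes fin: "finite S" "V = span S"
    and L_add: "\<And>u v. u \<in> V \<Longrightarrow> v \<in> V \<Longrightarrow> L (u + v) = L u + L v"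
    and L_scale: "\<And>c u. u \<in> V \<Longrightarrow> L (c *\<^sub>R u) = c * L u"
    and L_null: "\<And>u. u \<in> V \<Longrightarrow> a u u = 0 \<Longrightarrow> L u = 0"
  shows "\<exists>u\<in>V. \<forall>v\<in>V. a u v = L v"
proof -
  have "S \<subseteq> V" using fin by (auto intro: span_base)
  then obtain E where E: "orthonormal E"
      and null: "\<And>v. v \<in> V \<Longrightarrow> a (residual E v) (residual E v) = 0"
    using orthonormal_modulo_kernel[OF fin(1)] fin(2) by auto
  have EV: "E \<subseteq> V" "finite E" using E by (auto simp: orthonormal_def)
  have L_sum: "L (\<Sum>e\<in>F. c e *\<^sub>R e) = (\<Sum>e\<in>F. c e * L e)" if "finite F" "F \<subseteq> V" for F c
    using that
  proof (induction F)
    case empty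
    then show ?case using L_scale[of 0 0] V_closed by simp
  next
    case (insert e F)
    then show ?case
      by (simp add: L_add L_scale V_closed subset_eq)
  qed
  define u where "u = (\<Sum>e\<in>E. L e *\<^sub>R e)"
  have uV: "u \<in> V" unfolding u_def using EV by (auto intro!: V_closed)
  have "a u v = L v" if v: "v \<in> V" for v
  proof -
    have s: "(\<Sum>e\<in>E. a v e *\<^sub>R e) \<in> V" using EV by (auto intro!: V_closed)
    have r: "residual E v \<in> V" using residual_in EV v by blast
    have "v = residual E v + (\<Sum>e\<in>E. a v e *\<^sub>R e)" by (simp add: residual_def)
    then have "L v = L (residual E v) + L (\<Sum>e\<in>E. a v e *\<^sub>R e)" using L_add r s by metis
    also have "\<dots> = (\<Sum>e\<in>E. a v e * L e)"
      using L_null[OF r null[OF v]] L_sum EV by simp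
    also have "\<dots> = (\<Sum>e\<in>E. L e * a e v)"
      by (rule sum.cong) (use EV v sym in auto)
    also have "\<dots> = a u v"
      unfolding u_def using EV v by (intro sum_left[symmetric]) auto
    finally show ?thesis by simp
  qed
  then show ?thesis using uV by blast
qed

end

lemma semi_inner_combination:
  assumes a: "semi_inner V a" and b: "semi_inner V b" and pos: "0 \<le> \<alpha>" "0 \<le> \<beta>"
  shows "semi_inner V (\<lambda>u v. \<alpha> * a u v + \<beta> * b u v)"
proof -
  interpret a: semi_inner V a by fact
  interpret b: semi_inner V b by fact
  show ?thesis
  proof
    show "subspace V" by (rule a.subspace_V)
  qed (use pos in \<open>simp_all add: a.sym b.sym a.add_left b.add_left a.scale_left b.scale_left
      a.nonneg b.nonneg algebra_simps\<close>)
qed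

section \<open>Convex implicit steps in a finitely generated space\<close>

text \<open>
  Coordinates are functions on a finite index set extended by \<open>0\<close>, so that the number of
  coordinates need not be a type.  In the product topology a box is compact, and outside a box
  whose half-width is dictated by coercivity the function exceeds its value at the origin.
\<close>
lemma coercive_attains_min:
  fixes f :: "('i \<Rightarrow> real) \<Rightarrow> real"
  assumes fin: "finite I" and cont: "continuous_on UNIV f" and c: "0 < c"
    and lower: "\<And>x. c * (\<Sum>i\<in>I. (x i)\<^sup>2) - C \<le> f x"
  shows "\<exists>x. (\<forall>i. i \<notin> I \<longrightarrow> x i = 0) \<and> (\<forall>y. (\<forall>i. i \<notin> I \<longrightarrow> y i = 0) \<longrightarrow> f x \<le> f y)"
proof -
  define R where "R = sqrt (max 0 ((f (\<lambda>_. 0) + C) / c) )"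
  have R0: "R \<ge> 0" by (simp add: R_def)
  define Q where "Q = PiE UNIV (\<lambda>i. if i \<in> I then {-R..R} else {0::real})"
  have "compactin (product_topology (\<lambda>i::'i. euclidean) UNIV) Q"
    unfolding Q_def compactin_PiE by auto
  then have "compact Q" by (simp add: euclidean_product_topology)
  moreover have z: "(\<lambda>_. 0) \<in> Q" using R0 by (auto simp: Q_def PiE_def)
  ultimately obtain x where x: "x \<in> Q" "\<And>y. y \<in> Q \<Longrightarrow> f x \<le> f y"
    using continuous_attains_inf[of Q f] cont continuous_on_subset by blast
  have "f x \<le> f y" if y: "\<forall>i. i \<notin> I \<longrightarrow> y i = 0" for y
  proof (cases "y \<in> Q")
    case True
    then show ?thesis using x by blast
  next
    case False
    then obtain i where i: "i \<in> I" "\<not> (-R \<le> y i \<and> y i \<le> R)"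
      using y unfolding Q_def by (fastforce simp: PiE_def)
    then have "R < \<bar>y i\<bar>" by auto
    then have "R\<^sup>2 < (y i)\<^sup>2" using R0 by (metis abs_ge_zero abs_le_square_iff abs_of_nonneg not_less power2_abs)
    moreover have "(y i)\<^sup>2 \<le> (\<Sum>i\<in>I. (y i)\<^sup>2)" using fin i(1) by (intro member_le_sum) auto
    moreover have "(f (\<lambda>_. 0) + C) / c \<le> R\<^sup>2" by (simp add: R_def)
    ultimately have "(f (\<lambda>_. 0) + C) / c < (\<Sum>i\<in>I. (y i)\<^sup>2)" by linarith
    then have "f (\<lambda>_. 0) + C < c * (\<Sum>i\<in>I. (y i)\<^sup>2)"
      using c by (simp add: pos_divide_less_eq mult.commute)
    then have "f (\<lambda>_. 0) < f y" using lower[of y] by linarith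
    then show ?thesis using x(2)[OF z] by linarith
  qed
  moreover have "\<forall>i. i \<notin> I \<longrightarrow> x i = 0" using x(1) by (auto simp: Q_def PiE_iff split: if_splits)
  ultimately show ?thesis by blast
qed

text \<open>
  In operator form the system reads \<open>(\<phi> - \<phi>\<^sub>0) / \<tau> = - B \<mu>\<close> and \<open>\<mu> = E'(\<phi>)\<close>: an implicit step of the
  gradient flow of \<open>E\<close> with mobility \<open>B\<close>.  Since \<open>B\<close> may be singular, the functional to be minimised
  is written in terms of the chemical potential.  With \<open>B\<close>-orthonormal \<open>e\<^sub>i\<close> and \<open>r\<^sub>i\<close> the
  \<open>m\<close>-representer of \<open>B e\<^sub>i\<close>, consider
  \<open>J(x) = E(\<phi>\<^sub>0 - \<tau> (\<Sum>i. x\<^sub>i r\<^sub>i)) + \<tau> / 2 (\<Sum>i. x\<^sub>i\<^sup>2)\<close>.  It is coercive as soon as \<open>E\<close> is bounded below.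
  At a minimiser, \<open>E'(\<phi>) r\<^sub>i = x\<^sub>i\<close>; if \<open>\<mu>\<close> represents \<open>E'(\<phi>)\<close>, this says \<open>B \<mu> e\<^sub>i = x\<^sub>i\<close>, so
  \<open>\<mu>\<close> and \<open>\<Sum>i. x\<^sub>i e\<^sub>i\<close> differ by a null vector of \<open>B\<close> and the first equation follows.

  For uniqueness, test the difference of the first equations with \<open>\<mu>' - \<mu>\<close> and that of the second
  ones with \<open>\<phi>' - \<phi>\<close>: the term \<open>m (\<phi>' - \<phi>) (\<mu>' - \<mu>)\<close> is \<open>\<le> 0\<close> by the first and equals
  \<open>(E'(\<phi>') - E'(\<phi>)) (\<phi>' - \<phi>)\<close> by the second, which strict monotonicity makes positive unless
  \<open>\<phi>' = \<phi>\<close>.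
\<close>
theorem implicit_gradient_step:
  fixes V :: "'v::real_vector set" and m B DE :: "'v \<Rightarrow> 'v \<Rightarrow> real" and E :: "'v \<Rightarrow> real"
  assumes m: "semi_inner V m" and m_def: "\<And>v. v \<in> V \<Longrightarrow> m v v = 0 \<Longrightarrow> v = 0"
    and B: "semi_inner V B"
    and fin: "finite S" "V = span S" and \<phi>\<^sub>0: "\<phi>\<^sub>0 \<in> V" and \<tau>: "0 < \<tau>"
    and bdd: "\<And>v. v \<in> V \<Longrightarrow> - C \<le> E v"
    and deriv: "\<And>u v. u \<in> V \<Longrightarrow> v \<in> V \<Longrightarrow> ((\<lambda>s. E (u + s *\<^sub>R v)) has_real_derivative DE u v) (at 0)"
    and DE_add: "\<And>u v w. u \<in> V \<Longrightarrow> v \<in> V \<Longrightarrow> w \<in> V \<Longrightarrow> DE u (v + w) = DE u v + DE u w"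
    and DE_scale: "\<And>u v c. u \<in> V \<Longrightarrow> v \<in> V \<Longrightarrow> DE u (c *\<^sub>R v) = c * DE u v"
    and cont: "\<And>I g. finite I \<Longrightarrow> g ` I \<subseteq> V \<Longrightarrow>
      continuous_on UNIV (\<lambda>x :: 'v \<Rightarrow> real. E (\<phi>\<^sub>0 + (\<Sum>i\<in>I. x i *\<^sub>R g i)))"
    and mono: "\<And>u v. u \<in> V \<Longrightarrow> v \<in> V \<Longrightarrow> DE u (u - v) - DE v (u - v) \<le> 0 \<Longrightarrow> u = v"
  shows "\<exists>!(\<mu>, \<phi>). \<mu> \<in> V \<and> \<phi> \<in> V \<and> (\<forall>\<nu>\<in>V. m (\<phi> - \<phi>\<^sub>0) \<nu> + \<tau> * B \<mu> \<nu> = 0) \<and>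
           (\<forall>\<psi>\<in>V. m \<mu> \<psi> = DE \<phi> \<psi>)"
proof -
  interpret m: semi_inner V m by fact
  interpret B: semi_inner V B by fact
  have riesz: "\<exists>u\<in>V. \<forall>v\<in>V. m u v = L v"
    if "\<And>u v. u \<in> V \<Longrightarrow> v \<in> V \<Longrightarrow> L (u + v) = L u + L v"
       "\<And>c u. u \<in> V \<Longrightarrow> L (c *\<^sub>R u) = c * L u" for L
  proof (rule m.riesz_representation[OF fin that])
    fix u assume "u \<in> V" "m u u = 0"
    then show "L u = 0" using m_def that(2)[of 0 0] by fastforce
  qed
  have "S \<subseteq> V" using fin by (auto intro: span_base)
  then obtain D where D: "B.orthonormal D"
      and null: "\<And>v. v \<in> V \<Longrightarrow> B (B.residual D v) (B.residual D v) = 0"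
    using B.orthonormal_modulo_kernel[OF fin(1)] fin(2) by auto
  have DV: "D \<subseteq> V" "finite D" using D by (auto simp: B.orthonormal_def)
  have "\<exists>r\<in>V. \<forall>v\<in>V. m r v = B e v" if "e \<in> V" for e
    by (rule riesz) (use that in \<open>auto simp: B.add_right B.scale_right\<close>)
  then obtain r where r: "\<And>e. e \<in> V \<Longrightarrow> r e \<in> V" "\<And>e v. e \<in> V \<Longrightarrow> v \<in> V \<Longrightarrow> m (r e) v = B e v"
    by metis
  define \<Phi> where "\<Phi> x = \<phi>\<^sub>0 + (\<Sum>e\<in>D. x e *\<^sub>R ((- \<tau>) *\<^sub>R r e))" for x
  have gV: "(- \<tau>) *\<^sub>R r e \<in> V" if "e \<in> D" for e using that DV r by (intro m.V_closed) auto
  have \<Phi>V: "\<Phi> x \<in> V" for x unfolding \<Phi>_def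
    by (intro m.V_closed(2)[OF \<phi>\<^sub>0] m.V_closed(5) m.V_closed(4)[OF gV])
  define J where "J x = E (\<Phi> x) + \<tau> / 2 * (\<Sum>e\<in>D. (x e)\<^sup>2)" for x
  have "continuous_on UNIV J"
    unfolding J_def \<Phi>_def
    by (intro continuous_intros cont DV) (use gV in \<open>auto intro: continuous_on_product_coordinates\<close>)
  moreover have "\<tau> / 2 * (\<Sum>e\<in>D. (x e)\<^sup>2) - C \<le> J x" for x
    using bdd[OF \<Phi>V] by (simp add: J_def)
  ultimately obtain x where x0: "\<And>e. e \<notin> D \<Longrightarrow> x e = 0"
      and xmin: "\<And>y. (\<And>e. e \<notin> D \<Longrightarrow> y e = 0) \<Longrightarrow> J x \<le> J y"
    using coercive_attains_min[OF DV(2), of J "\<tau> / 2" C] \<tau> by auto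
  define \<phi> where "\<phi> = \<Phi> x"
  have \<phi>V: "\<phi> \<in> V" using \<Phi>V by (simp add: \<phi>_def)
  \<comment> \<open>Stationarity in the coordinate \<open>e\<close>.\<close>
  have crit: "DE \<phi> (r e) = x e" if e: "e \<in> D" for e
  proof -
    define v where "v = (- \<tau>) *\<^sub>R r e"
    have vV: "v \<in> V" using gV e by (simp add: v_def)
    have J1: "J (x(e := x e + s)) = E (\<phi> + s *\<^sub>R v) + \<tau> / 2 * (\<Sum>e\<in>D. (x e)\<^sup>2) + \<tau> / 2 * (2 * x e * s + s\<^sup>2)" for s
    proof -
      have "(\<Sum>f\<in>D. (x(e := x e + s)) f *\<^sub>R ((- \<tau>) *\<^sub>R r f)) = (\<Sum>f\<in>D. x f *\<^sub>R ((- \<tau>) *\<^sub>R r f)) + s *\<^sub>R v"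
        using e DV(2) by (simp add: sum.remove[of D e] v_def algebra_simps)
      moreover have "(\<Sum>f\<in>D. ((x(e := x e + s)) f)\<^sup>2) = (\<Sum>f\<in>D. (x f)\<^sup>2) + (2 * x e * s + s\<^sup>2)"
        using e DV(2) by (simp add: sum.remove[of D e] power2_eq_square algebra_simps)
      ultimately show ?thesis by (simp add: J_def \<phi>_def \<Phi>_def algebra_simps)
    qed
    have "((\<lambda>s. E (\<phi> + s *\<^sub>R v) + \<tau> / 2 * (\<Sum>e\<in>D. (x e)\<^sup>2) + \<tau> / 2 * (2 * x e * s + s\<^sup>2))
        has_real_derivative DE \<phi> v + \<tau> * x e) (at 0)"
      by (rule derivative_eq_intros deriv[OF \<phi>V vV] refl | simp)+
    then have der: "((\<lambda>s. J (x(e := x e + s))) has_real_derivative DE \<phi> v + \<tau> * x e) (at 0)"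
      by (simp add: J1)
    have "DE \<phi> v + \<tau> * x e = 0"
    proof (rule DERIV_local_min[OF der, of 1])
      show "\<forall>s. \<bar>0 - s\<bar> < 1 \<longrightarrow> J (x(e := x e + 0)) \<le> J (x(e := x e + s))"
      proof -
        have "J x \<le> J (x(e := x e + s))" for s by (rule xmin) (use x0 e in auto)
        then show ?thesis by simp
      qed
    qed simp
    then have "\<tau> * (x e - DE \<phi> (r e)) = 0"
      using DE_scale[OF \<phi>V r(1), of e "- \<tau>"] e DV by (auto simp: v_def algebra_simps)
    then show ?thesis using \<tau> by simp
  qed
  obtain \<mu> where \<mu>V: "\<mu> \<in> V" and \<mu>: "\<And>\<psi>. \<psi> \<in> V \<Longrightarrow> m \<mu> \<psi> = DE \<phi> \<psi>"
    using riesz[of "DE \<phi>"] DE_add DE_scale \<phi>V by blast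
  have coord: "B \<mu> e = x e" if e: "e \<in> D" for e
  proof -
    have eV: "e \<in> V" using e DV by blast
    have "B \<mu> e = m (r e) \<mu>" using r(2)[OF eV \<mu>V] B.sym eV \<mu>V by simp
    also have "\<dots> = x e" using \<mu>[OF r(1)[OF eV]] m.sym[OF r(1)[OF eV] \<mu>V] crit[OF e] by simp
    finally show ?thesis .
  qed
  \<comment> \<open>The residual of \<open>\<mu>\<close> is null for \<open>B\<close>, so only its coordinates \<open>x\<close> enter.\<close>
  have balance: "m (\<phi> - \<phi>\<^sub>0) \<nu> + \<tau> * B \<mu> \<nu> = 0" if \<nu>: "\<nu> \<in> V" for \<nu>
  proof -
    have "B (B.residual D \<mu>) \<nu> = 0"
      using B.null_orthogonal B.residual_in[OF DV(1) \<mu>V] null[OF \<mu>V] \<nu> by blast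
    moreover have "B (B.residual D \<mu>) \<nu> = B \<mu> \<nu> - (\<Sum>e\<in>D. B \<mu> e * B e \<nu>)"
      unfolding B.residual_def using DV \<nu> \<mu>V
      by (subst B.diff_left) (auto intro!: B.V_closed B.sum_left)
    ultimately have "B \<mu> \<nu> = (\<Sum>e\<in>D. x e * B e \<nu>)" by (simp add: coord)
    moreover have "m (\<phi> - \<phi>\<^sub>0) \<nu> = (\<Sum>e\<in>D. x e * m ((- \<tau>) *\<^sub>R r e) \<nu>)"
      unfolding \<phi>_def \<Phi>_def using m.sum_left[of D "\<lambda>e. (- \<tau>) *\<^sub>R r e" \<nu> x] gV \<nu> by auto
    moreover have "m ((- \<tau>) *\<^sub>R r e) \<nu> = - \<tau> * B e \<nu>" if "e \<in> D" for e
      using that DV r \<nu> by (subst m.scale_left) auto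
    ultimately show ?thesis by (simp add: sum_distrib_left sum_negf algebra_simps)
  qed
  show ?thesis
  proof (rule ex1I[of _ "(\<mu>, \<phi>)"])
    show "case (\<mu>, \<phi>) of (\<mu>, \<phi>) \<Rightarrow> \<mu> \<in> V \<and> \<phi> \<in> V \<and> (\<forall>\<nu>\<in>V. m (\<phi> - \<phi>\<^sub>0) \<nu> + \<tau> * B \<mu> \<nu> = 0) \<and>
           (\<forall>\<psi>\<in>V. m \<mu> \<psi> = DE \<phi> \<psi>)"
      using \<mu>V \<phi>V \<mu> balance by simp
  next
    fix z
    assume "case z of (\<mu>, \<phi>) \<Rightarrow> \<mu> \<in> V \<and> \<phi> \<in> V \<and> (\<forall>\<nu>\<in>V. m (\<phi> - \<phi>\<^sub>0) \<nu> + \<tau> * B \<mu> \<nu> = 0) \<and>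
           (\<forall>\<psi>\<in>V. m \<mu> \<psi> = DE \<phi> \<psi>)"
    moreover obtain \<mu>' \<phi>' where z: "z = (\<mu>', \<phi>')" by fastforce
    ultimately have V': "\<mu>' \<in> V" "\<phi>' \<in> V"
      and bal': "\<And>\<nu>. \<nu> \<in> V \<Longrightarrow> m (\<phi>' - \<phi>\<^sub>0) \<nu> + \<tau> * B \<mu>' \<nu> = 0"
      and \<mu>': "\<And>\<psi>. \<psi> \<in> V \<Longrightarrow> m \<mu>' \<psi> = DE \<phi>' \<psi>" by auto
    define d where "d = \<mu>' - \<mu>"
    define f where "f = \<phi>' - \<phi>"
    have dV: "d \<in> V" and fV: "f \<in> V" using V' \<mu>V \<phi>V by (auto simp: d_def f_def intro: m.V_closed)
    have "m f d = m (\<phi>' - \<phi>\<^sub>0) d - m (\<phi> - \<phi>\<^sub>0) d"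
      using m.diff_left[of "\<phi>' - \<phi>\<^sub>0" "\<phi> - \<phi>\<^sub>0" d] V' \<phi>V \<phi>\<^sub>0 dV by (simp add: f_def m.V_closed)
    also have "\<dots> = - \<tau> * B d d"
    proof -
      have "B d d = B \<mu>' d - B \<mu> d"
        using B.diff_left[OF V'(1) \<mu>V dV] unfolding d_def by simp
      then have "\<tau> * B d d = \<tau> * B \<mu>' d - \<tau> * B \<mu> d" by (simp add: right_diff_distrib)
      then show ?thesis using bal'[OF dV] balance[OF dV] by simp
    qed
    also have "\<dots> \<le> 0" using B.nonneg[OF dV] \<tau> by simp
    finally have "m d f \<le> 0" using m.sym dV fV by simp
    moreover have "m d f = DE \<phi>' f - DE \<phi> f"
      using m.diff_left[OF V'(1) \<mu>V fV] \<mu>[OF fV] \<mu>'[OF fV] unfolding d_def by simp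
    ultimately have "\<phi>' = \<phi>" using mono[OF V'(2) \<phi>V] by (simp add: f_def)
    then have "m d d = 0"
      using m.diff_left[OF V'(1) \<mu>V dV] \<mu>[OF dV] \<mu>'[OF dV] unfolding d_def by simp
    then have "d = 0" using m_def dV by blast
    then show "z = (\<mu>, \<phi>)" using z \<open>\<phi>' = \<phi>\<close> by (simp add: d_def)
  qed
qed

section \<open>Functions as vectors, and bounded continuous integrands\<close>

text \<open>
  The pointwise vector space structure makes the notions of span, independence and subspace
  applicable to sets of functions such as finite element spaces.
\<close>
instantiation "fun" :: (type, real_vector) real_vector
begin

definition scaleR_fun_def: "c *\<^sub>R f = (\<lambda>x. c *\<^sub>R f x)"

instance
  by standard (auto simp: scaleR_fun_def fun_eq_iff algebra_simps)

end

lemma scaleR_fun_apply [simp]: "(c *\<^sub>R f) x = c *\<^sub>R f x"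
  by (simp add: scaleR_fun_def)

lemma sum_fun_apply: "(\<Sum>i\<in>I. f i) x = (\<Sum>i\<in>I. f i x)"
  by (induction I rule: infinite_finite_induct) auto

text \<open>
  Discrete functions and their gradients are bounded and continuous on the union of the open
  elements.  This class is closed under all products in the scheme and consists of integrable
  functions, so no further integrability argument is needed.
\<close>
definition bcont :: "'a::topological_space set \<Rightarrow> ('a \<Rightarrow> 'b::real_normed_vector) \<Rightarrow> bool" where
  "bcont N F \<longleftrightarrow> continuous_on N F \<and> bounded (F ` N)"

lemma bcontI:
  assumes "continuous_on N F" "\<And>x. x \<in> N \<Longrightarrow> norm (F x) \<le> C"
  shows "bcont N F"
  using assms unfolding bcont_def bounded_iff by blast

lemma bcontE:
  assumes "bcont N F"
  obtains C where "continuous_on N F" "0 \<le> C" "\<And>x. x \<in> N \<Longrightarrow> norm (F x) \<le> C"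
proof -
  obtain C where "\<forall>x\<in>N. norm (F x) \<le> C"
    using assms unfolding bcont_def bounded_iff by blast
  then show thesis using assms that[of "max C 0"] unfolding bcont_def by force
qed

lemma bcont_const [simp]: "bcont N (\<lambda>x. c)"
  by (rule bcontI) auto

lemma bcont_add [simp]:
  assumes "bcont N F" "bcont N G"
  shows "bcont N (\<lambda>x. F x + G x)"
proof -
  obtain A where A: "continuous_on N F" "0 \<le> A" "\<And>x. x \<in> N \<Longrightarrow> norm (F x) \<le> A"
    using bcontE[OF assms(1)] by blast
  obtain B where B: "continuous_on N G" "0 \<le> B" "\<And>x. x \<in> N \<Longrightarrow> norm (G x) \<le> B"
    using bcontE[OF assms(2)] by blast
  show ?thesis
    by (rule bcontI[where C = "A + B"]) (use A B in \<open>auto intro!: continuous_intros norm_triangle_mono\<close>)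
qed

lemma bcont_scaleR [simp]:
  assumes "bcont N f" "bcont N G"
  shows "bcont N (\<lambda>x. f x *\<^sub>R G x)"
proof -
  obtain A where A: "continuous_on N f" "0 \<le> A" "\<And>x. x \<in> N \<Longrightarrow> norm (f x) \<le> A"
    using bcontE[OF assms(1)] by blast
  obtain B where B: "continuous_on N G" "0 \<le> B" "\<And>x. x \<in> N \<Longrightarrow> norm (G x) \<le> B"
    using bcontE[OF assms(2)] by blast
  show ?thesis
    by (rule bcontI[where C = "A * B"]) (use A B in \<open>auto intro!: continuous_intros mult_mono\<close>)
qed

lemma bcont_inner [simp]:
  fixes F :: "'a::topological_space \<Rightarrow> 'b::real_inner"
  assumes "bcont N F" "bcont N G"
  shows "bcont N (\<lambda>x. F x \<bullet> G x)"
proof -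
  obtain A where A: "continuous_on N F" "0 \<le> A" "\<And>x. x \<in> N \<Longrightarrow> norm (F x) \<le> A"
    using bcontE[OF assms(1)] by blast
  obtain B where B: "continuous_on N G" "0 \<le> B" "\<And>x. x \<in> N \<Longrightarrow> norm (G x) \<le> B"
    using bcontE[OF assms(2)] by blast
  have "norm (F x \<bullet> G x) \<le> A * B" if "x \<in> N" for x
    using Cauchy_Schwarz_ineq2[of "F x" "G x"] mult_mono[OF A(3)[OF that] B(3)[OF that] A(2)]
    by simp
  then show ?thesis using A B by (intro bcontI) (auto intro!: continuous_intros)
qed

lemma bcont_mult [simp]:
  fixes f g :: "'a::topological_space \<Rightarrow> real"
  shows "bcont N f \<Longrightarrow> bcont N g \<Longrightarrow> bcont N (\<lambda>x. f x * g x)"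
  using bcont_inner[of N f g] by simp

lemma bcont_minus [simp]: "bcont N F \<Longrightarrow> bcont N (\<lambda>x. - F x)"
  using bcont_scaleR[OF bcont_const[of N "-1"]] by simp

lemma bcont_diff [simp]: "bcont N F \<Longrightarrow> bcont N G \<Longrightarrow> bcont N (\<lambda>x. F x - G x)"
  using bcont_add[OF _ bcont_minus, of N F G] by simp

lemma bcont_power [simp]:
  fixes f :: "'a::topological_space \<Rightarrow> real"
  shows "bcont N f \<Longrightarrow> bcont N (\<lambda>x. f x ^ k)"
  by (induction k) auto

lemma bcont_integrable:
  fixes f :: "'a::euclidean_space \<Rightarrow> real"
  assumes "open N" "bounded N" "bcont N f"
  shows "integrable (lebesgue_on N) f"
proof -
  have N: "N \<in> lmeasurable" using assms by (simp add: lmeasurable_open)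
  obtain C where C: "continuous_on N f" "\<And>x. x \<in> N \<Longrightarrow> norm (f x) \<le> C"
    using bcontE[OF assms(3)] by blast
  show ?thesis
  proof (rule finite_measure.integrable_const_bound)
    show "finite_measure (lebesgue_on N)" using N by (rule finite_measure_lebesgue_on)
    show "AE x in lebesgue_on N. norm (f x) \<le> C" using C by (intro AE_I2) auto
    show "f \<in> borel_measurable (lebesgue_on N)"
      using C N by (intro continuous_imp_measurable_on_sets_lebesgue) auto
  qed
qed

text \<open>
  The integrand vanishes almost everywhere, and the set where it does not is open; an open null
  set is empty.
\<close>
lemma nonneg_integral_zero_imp_zero:
  fixes f :: "'a::euclidean_space \<Rightarrow> real"
  assumes N: "open N" "bounded N" and f: "bcont N f" and nonneg: "\<And>x. x \<in> N \<Longrightarrow> 0 \<le> f x"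
    and zero: "integral\<^sup>L (lebesgue_on N) f = 0" and x: "x \<in> N"
  shows "f x = 0"
proof -
  have "AE x in lebesgue_on N. 0 \<le> f x" using nonneg by (intro AE_I2) auto
  then have "AE x in lebesgue_on N. f x = 0"
    using integral_nonneg_eq_0_iff_AE[OF bcont_integrable[OF N f]] nonneg zero by auto
  then have "AE x in lebesgue. x \<in> N \<longrightarrow> f x = 0"
    using N by (subst (asm) AE_restrict_space_iff) auto
  then have "negligible {x \<in> N. f x \<noteq> 0}"
    by (simp add: completion.AE_iff_null_sets negligible_iff_null_sets)
  moreover have "open {x \<in> N. f x \<noteq> 0}"
  proof -
    have "open (N \<inter> f -` (- {0}))"
      using f N by (intro continuous_open_preimage) (auto simp: bcont_def)
    moreover have "N \<inter> f -` (- {0}) = {x \<in> N. f x \<noteq> 0}" by auto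
    ultimately show ?thesis by simp
  qed
  ultimately have "{x \<in> N. f x \<noteq> 0} = {}" using open_not_negligible by blast
  then show ?thesis using x by blast
qed

section \<open>Gradients of polynomials\<close>

text \<open>
  This class is closed under sums and products, which gives the smoothness of polynomials
  without a formula for the derivative of a monomial.
\<close>
definition has_continuous_gradient :: "(real ^ 'n \<Rightarrow> real) \<Rightarrow> bool" where
  "has_continuous_gradient f \<longleftrightarrow> (\<exists>D. continuous_on UNIV D \<and> (\<forall>x. GDERIV f x :> D x))"

lemma has_continuous_gradient_imp_continuous:
  "has_continuous_gradient f \<Longrightarrow> continuous_on UNIV f"
  unfolding has_continuous_gradient_def gderiv_def
  by (metis continuous_at_imp_continuous_on has_derivative_continuous)

lemma has_continuous_gradient_const: "has_continuous_gradient (\<lambda>x. c)"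
  unfolding has_continuous_gradient_def
  by (rule exI[of _ "\<lambda>x. 0"]) (auto intro: GDERIV_const)

lemma has_continuous_gradient_component: "has_continuous_gradient (\<lambda>x. x $ i)"
  unfolding has_continuous_gradient_def gderiv_def
  by (rule exI[of _ "\<lambda>x. axis i 1"])
    (auto simp: inner_axis intro!: bounded_linear_imp_has_derivative bounded_linear_vec_nth)

lemma has_continuous_gradient_add:
  assumes f: "has_continuous_gradient f" and g: "has_continuous_gradient g"
  shows "has_continuous_gradient (\<lambda>x. f x + g x)"
proof -
  obtain D D' where D: "continuous_on UNIV D" "\<And>x. GDERIV f x :> D x"
    and D': "continuous_on UNIV D'" "\<And>x. GDERIV g x :> D' x"
    using f g unfolding has_continuous_gradient_def by blast
  show ?thesis
    unfolding has_continuous_gradient_def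
    using continuous_on_add[OF D(1) D'(1)] GDERIV_add[OF D(2) D'(2)] by blast
qed

lemma has_continuous_gradient_mult:
  assumes f: "has_continuous_gradient f" and g: "has_continuous_gradient g"
  shows "has_continuous_gradient (\<lambda>x. f x * g x)"
proof -
  obtain D D' where D: "continuous_on UNIV D" "\<And>x. GDERIV f x :> D x"
    and D': "continuous_on UNIV D'" "\<And>x. GDERIV g x :> D' x"
    using f g unfolding has_continuous_gradient_def by blast
  have "continuous_on UNIV (\<lambda>x. f x *\<^sub>R D' x + g x *\<^sub>R D x)"
    using D(1) D'(1) f g by (intro continuous_intros has_continuous_gradient_imp_continuous)
  then show ?thesis
    unfolding has_continuous_gradient_def using GDERIV_mult[OF D(2) D'(2)] by blast
qed

lemma has_continuous_gradient_power:
  "has_continuous_gradient f \<Longrightarrow> has_continuous_gradient (\<lambda>x. f x ^ k)"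
  by (induction k) (auto intro: has_continuous_gradient_const has_continuous_gradient_mult)

lemma has_continuous_gradient_prod:
  "(\<And>i. i \<in> I \<Longrightarrow> has_continuous_gradient (f i)) \<Longrightarrow> has_continuous_gradient (\<lambda>x. \<Prod>i\<in>I. f i x)"
  by (induction I rule: infinite_finite_induct)
    (auto intro: has_continuous_gradient_const has_continuous_gradient_mult)

lemma has_continuous_gradient_sum:
  "(\<And>i. i \<in> I \<Longrightarrow> has_continuous_gradient (f i)) \<Longrightarrow> has_continuous_gradient (\<lambda>x. \<Sum>i\<in>I. f i x)"
  by (induction I rule: infinite_finite_induct)
    (auto intro: has_continuous_gradient_const has_continuous_gradient_add)

lemma GDERIV_imp_grad_eq:
  assumes "GDERIV u x :> D"
  shows "grad u x = D"
  unfolding grad_def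
proof (rule the_equality)
  fix D' assume "GDERIV u x :> D'"
  with assms have "(\<lambda>h. h \<bullet> D') = (\<lambda>h. h \<bullet> D)"
    unfolding gderiv_def by (rule has_derivative_unique[rotated])
  then have "\<forall>h. h \<bullet> D' = h \<bullet> D" by (simp add: fun_eq_iff)
  then show "D' = D" by (simp only: vector_eq_ldot)
qed fact

lemma finite_multi_indices: "finite {\<alpha> :: 'n::finite \<Rightarrow> nat. (\<Sum>i\<in>UNIV. \<alpha> i) \<le> r}"
proof (rule finite_subset)
  show "{\<alpha> :: 'n \<Rightarrow> nat. (\<Sum>i\<in>UNIV. \<alpha> i) \<le> r} \<subseteq> PiE UNIV (\<lambda>_. {..r})"
  proof
    fix \<alpha> :: "'n \<Rightarrow> nat" assume "\<alpha> \<in> {\<alpha>. (\<Sum>i\<in>UNIV. \<alpha> i) \<le> r}"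
    moreover have "\<alpha> i \<le> (\<Sum>i\<in>UNIV. \<alpha> i)" for i by (intro member_le_sum) auto
    ultimately show "\<alpha> \<in> PiE UNIV (\<lambda>_. {..r})" by (auto intro: order_trans)
  qed
qed (auto intro: finite_PiE)

section \<open>Monotonicity of the cubic nonlinearity\<close>

lemma cube_monotone: "0 \<le> ((a::real) ^ 3 - b ^ 3) * (a - b)"
  and cube_strictly_monotone: "(a ^ 3 - b ^ 3) * (a - b) = 0 \<Longrightarrow> a = b"
proof -
  have eq: "(a ^ 3 - b ^ 3) * (a - b) = (a - b)\<^sup>2 * ((a + b / 2)\<^sup>2 + 3 / 4 * b\<^sup>2)"
    by (simp add: power2_eq_square power3_eq_cube field_simps)
  then show "0 \<le> (a ^ 3 - b ^ 3) * (a - b)" by simp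
  assume "(a ^ 3 - b ^ 3) * (a - b) = 0"
  then have "a = b \<or> (a + b / 2)\<^sup>2 + 3 / 4 * b\<^sup>2 = 0" unfolding eq by simp
  moreover have "(a + b / 2)\<^sup>2 + 3 / 4 * b\<^sup>2 = 0 \<Longrightarrow> b = 0 \<and> a + b / 2 = 0"
    by (simp add: add_nonneg_eq_0_iff)
  ultimately show "a = b" by auto
qed

section \<open>Integration over the open elements of a mesh\<close>

locale mesh =
  fixes \<Omega> :: "(real ^ 'n) set" and \<T> :: "(real ^ 'n) set set"
  assumes domain: "polytopal_domain \<Omega>" and mesh: "simplicial_mesh \<Omega> \<T>"
begin

text \<open>
  The union of the open elements carries all integrals: it differs from \<open>\<Omega>\<close> by a null set, and
  on it every discrete function is differentiable.
\<close>
definition N :: "(real ^ 'n) set" where "N = (\<Union>K\<in>\<T>. interior K)"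

lemma domain_basics: "\<Omega> \<noteq> {}" "open \<Omega>" "connected \<Omega>" "bounded \<Omega>"
  using domain by (auto simp: polytopal_domain_def)

lemma finite_mesh: "finite \<T>" and Union_mesh: "\<Union>\<T> = closure \<Omega>"
  using mesh by (auto simp: simplicial_mesh_def triangulation_def)

lemma element:
  assumes "K \<in> \<T>"
  shows "convex K" "compact K" "interior K \<noteq> {}" "closure (interior K) = K"
proof -
  have s: "int CARD('n) simplex K" using assms mesh by (auto simp: simplicial_mesh_def)
  then show "convex K" "compact K" by (auto dest!: simplex_imp_polytope simp: polytope_imp_convex polytope_imp_compact)
  moreover have "K \<noteq> {}" "aff_dim K = int DIM(real ^ 'n)" using aff_dim_simplex[OF s] by auto
  ultimately show int: "interior K \<noteq> {}"
    by (metis interior_rel_interior_gen rel_interior_eq_empty)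
  show "closure (interior K) = K"
    using convex_closure_interior[OF \<open>convex K\<close> int] \<open>compact K\<close>
    by (simp add: compact_imp_closed closure_closed)
qed

lemma open_N: "open N" by (auto simp: N_def)

lemma N_subset: "N \<subseteq> closure \<Omega>"
  using interior_subset unfolding N_def Union_mesh[symmetric] by blast

lemma bounded_N: "bounded N"
  using N_subset domain_basics bounded_subset by blast

text \<open>
  What is missing lies on the boundaries of the finitely many convex elements.
\<close>
lemma negligible_outside_N: "negligible (\<Omega> - N)"
proof (rule negligible_subset)
  show "negligible (\<Union>(frontier ` \<T>))"
    using finite_mesh element by (intro negligible_Union) (auto intro: negligible_convex_frontier)
  show "\<Omega> - N \<subseteq> \<Union>(frontier ` \<T>)"
  proof
    fix x assume x: "x \<in> \<Omega> - N"
    then obtain K where K: "K \<in> \<T>" "x \<in> K" using Union_mesh closure_subset by blast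
    then have "x \<in> frontier K"
      using x closure_subset[of K] by (auto simp: frontier_def N_def)
    then show "x \<in> \<Union>(frontier ` \<T>)" using K by blast
  qed
qed

text \<open>
  An open element may cross the boundary of \<open>\<Omega>\<close> (a slit, for instance), but that boundary is a
  finite union of polytopes of lower dimension.
\<close>
lemma negligible_N_outside: "negligible (N - \<Omega>)"
proof (rule negligible_subset)
  obtain \<F> where \<F>: "finite \<F>" "frontier \<Omega> = \<Union>\<F>"
      "\<And>F. F \<in> \<F> \<Longrightarrow> polytope F \<and> aff_dim F = int CARD('n) - 1"
    using domain unfolding polytopal_domain_def by metis
  have "negligible F" if "F \<in> \<F>" for F
  proof -
    have "convex F" using \<F>(3)[OF that] by (simp add: polytope_imp_convex)
    moreover have "interior F = {}"
      using \<F>(3)[OF that] aff_dim_nonempty_interior[of F] by force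
    ultimately show ?thesis
      using negligible_convex_frontier[of F] closure_subset[of F]
      by (auto simp: frontier_def intro: negligible_subset)
  qed
  then show "negligible (frontier \<Omega>)" unfolding \<F>(2) using \<F>(1) by (intro negligible_Union)
  show "N - \<Omega> \<subseteq> frontier \<Omega>"
    using N_subset domain_basics(2) by (auto simp: frontier_def interior_open)
qed

lemma set_integrable_iff_N:
  fixes f :: "real ^ 'n \<Rightarrow> real"
  shows "set_integrable lebesgue \<Omega> f \<longleftrightarrow> set_integrable lebesgue N f"
  by (intro absolutely_integrable_spike_set_eq
      negligible_subset[OF negligible_outside_N] negligible_subset[OF negligible_N_outside]) auto

lemma bcont_set_integrable_N:
  fixes f :: "real ^ 'n \<Rightarrow> real"
  assumes "bcont N f"
  shows "set_integrable lebesgue N f"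
  using bcont_integrable[OF open_N bounded_N assms] open_N
  by (simp add: integrable_restrict_space set_integrable_def)

abbreviation I :: "(real ^ 'n \<Rightarrow> real) \<Rightarrow> real" where
  "I f \<equiv> integral\<^sup>L (lebesgue_on N) f"

lemma set_integral_eq_I:
  assumes "bcont N f"
  shows "(LINT x:\<Omega>|lebesgue. f x) = I f"
proof -
  have N: "set_integrable lebesgue N f" by (rule bcont_set_integrable_N) fact
  have "(LINT x:\<Omega>|lebesgue. f x) = integral \<Omega> f"
    using N set_integrable_iff_N by (intro set_lebesgue_integral_eq_integral(2)) auto
  also have "\<dots> = integral N f"
    by (intro integral_spike_set
        negligible_subset[OF negligible_outside_N] negligible_subset[OF negligible_N_outside]) auto
  also have "\<dots> = (LINT x:N|lebesgue. f x)"
    using N by (intro set_lebesgue_integral_eq_integral(2)[symmetric])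
  also have "\<dots> = I f"
    using open_N by (simp add: integral_restrict_space set_lebesgue_integral_def)
  finally show ?thesis .
qed

lemma L2_inner_eq_I:
  "bcont N (\<lambda>x. F x \<bullet> G x) \<Longrightarrow> L2_inner \<Omega> F G = I (\<lambda>x. F x \<bullet> G x)"
  unfolding L2_inner_def by (rule set_integral_eq_I)

lemma I_add: "bcont N f \<Longrightarrow> bcont N g \<Longrightarrow> I (\<lambda>x. f x + g x) = I f + I g"
  by (intro Bochner_Integration.integral_add bcont_integrable open_N bounded_N)

lemma I_diff: "bcont N f \<Longrightarrow> bcont N g \<Longrightarrow> I (\<lambda>x. f x - g x) = I f - I g"
  by (intro Bochner_Integration.integral_diff bcont_integrable open_N bounded_N)

lemma I_scale: "I (\<lambda>x. c * f x) = c * I f"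
  by simp

lemma I_cong: "(\<And>x. x \<in> N \<Longrightarrow> f x = g x) \<Longrightarrow> I f = I g"
  by (intro Bochner_Integration.integral_cong) auto

lemma I_mono: "bcont N f \<Longrightarrow> bcont N g \<Longrightarrow> (\<And>x. x \<in> N \<Longrightarrow> f x \<le> g x) \<Longrightarrow> I f \<le> I g"
  by (intro integral_mono bcont_integrable open_N bounded_N) auto

lemma I_nonneg: "(\<And>x. x \<in> N \<Longrightarrow> 0 \<le> f x) \<Longrightarrow> 0 \<le> I f"
  by (intro integral_nonneg_AE AE_I2) auto

lemmas I_zeroD = nonneg_integral_zero_imp_zero[OF open_N bounded_N]

lemma I_one_pos: "0 < I (\<lambda>x. 1)"
proof -
  have "I (\<lambda>x. 1) \<noteq> 0"
  proof
    assume z: "I (\<lambda>x. 1) = 0"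
    have "N = {}" using I_zeroD[OF bcont_const _ z] by force
    then have "\<T> = {}" using element unfolding N_def by auto
    then show False using Union_mesh domain_basics(1) closure_subset by auto
  qed
  then show ?thesis using I_nonneg[of "\<lambda>x. 1"] by linarith
qed

section \<open>Finite element functions\<close>

abbreviation fe :: "nat \<Rightarrow> (real ^ 'n \<Rightarrow> real) set" where
  "fe r \<equiv> fe_space \<Omega> \<T> r"

lemma fe_continuous: "v \<in> fe r \<Longrightarrow> continuous_on (closure \<Omega>) v"
  by (simp add: fe_space_def)

lemma fe_bcont [simp]:
  assumes "v \<in> fe r"
  shows "bcont N v"
proof -
  have "bounded (v ` closure \<Omega>)"
    using assms domain_basics(4)
    by (intro compact_imp_bounded compact_continuous_image fe_continuous) auto
  then show ?thesis
    using fe_continuous[OF assms] N_subset unfolding bcont_def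
    by (meson bounded_subset continuous_on_subset image_mono)
qed

lemma fe_local_gradient:
  assumes v: "v \<in> fe r" and K: "K \<in> \<T>"
  shows "\<exists>D. continuous_on UNIV D \<and> (\<forall>x\<in>interior K. GDERIV v x :> D x)"
proof -
  obtain a :: "('n \<Rightarrow> nat) \<Rightarrow> real" where
    a: "\<And>x. x \<in> K \<Longrightarrow> v x = (\<Sum>\<alpha> | (\<Sum>i\<in>UNIV. \<alpha> i) \<le> r. a \<alpha> * (\<Prod>i\<in>UNIV. (x $ i) ^ \<alpha> i))"
    using v K unfolding fe_space_def is_poly_on_def by blast
  define p where "p x = (\<Sum>\<alpha> | (\<Sum>i\<in>UNIV. \<alpha> i) \<le> r. a \<alpha> * (\<Prod>i\<in>UNIV. (x $ i) ^ \<alpha> i))"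
    for x :: "real ^ 'n"
  have "has_continuous_gradient p"
    unfolding p_def
    by (intro has_continuous_gradient_sum has_continuous_gradient_mult has_continuous_gradient_const
        has_continuous_gradient_prod has_continuous_gradient_power has_continuous_gradient_component)
  then obtain D where D: "continuous_on UNIV D" "\<And>x. GDERIV p x :> D x"
    unfolding has_continuous_gradient_def by blast
  have "GDERIV v x :> D x" if x: "x \<in> interior K" for x
    unfolding gderiv_def
  proof (rule has_derivative_transform_within_open[OF _ open_interior x])
    show "(p has_derivative (\<lambda>h. h \<bullet> D x)) (at x)" using D(2) by (simp add: gderiv_def)
    show "p y = v y" if "y \<in> interior K" for y
      using a[of y] that interior_subset[of K] unfolding p_def by auto
  qed
  then show ?thesis using D(1) by blast
qed

lemma fe_GDERIV:
  assumes "v \<in> fe r" "x \<in> N"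
  shows "GDERIV v x :> grad v x"
proof -
  obtain K where "K \<in> \<T>" "x \<in> interior K" using assms by (auto simp: N_def)
  then obtain D where "GDERIV v x :> D" using fe_local_gradient[OF assms(1)] by blast
  then show ?thesis by (simp add: GDERIV_imp_grad_eq)
qed

lemma fe_grad_bcont [simp]:
  assumes v: "v \<in> fe r"
  shows "bcont N (grad v)"
proof -
  have loc: "continuous_on (interior K) (grad v) \<and> bounded (grad v ` interior K)" if K: "K \<in> \<T>" for K
  proof -
    obtain D where D: "continuous_on UNIV D" "\<And>x. x \<in> interior K \<Longrightarrow> GDERIV v x :> D x"
      using fe_local_gradient[OF v K] by blast
    then have eq: "grad v x = D x" if "x \<in> interior K" for x
      using that GDERIV_imp_grad_eq by blast
    have "continuous_on (interior K) D" using D continuous_on_subset by blast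
    moreover have "bounded (D ` K)"
      using D element(2)[OF K]
      by (intro compact_imp_bounded compact_continuous_image) (auto intro: continuous_on_subset)
    then have "bounded (D ` interior K)" by (meson bounded_subset image_mono interior_subset)
    ultimately show ?thesis using eq by (metis continuous_on_cong image_cong)
  qed
  have "continuous_on N (grad v)"
    unfolding N_def using loc by (intro continuous_on_open_UN) auto
  moreover have "bounded (grad v ` N)"
    unfolding N_def image_UN using loc finite_mesh by (intro bounded_UN) auto
  ultimately show ?thesis by (simp add: bcont_def)
qed

lemma grad_add:
  assumes "u \<in> fe r" "v \<in> fe s" "x \<in> N"
  shows "grad (u + v) x = grad u x + grad v x"
proof (rule GDERIV_imp_grad_eq)
  show "GDERIV (u + v) x :> grad u x + grad v x"
    using GDERIV_add[OF fe_GDERIV[OF assms(1,3)] fe_GDERIV[OF assms(2,3)]]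
    unfolding plus_fun_def .
qed

lemma grad_scale:
  assumes "u \<in> fe r" "x \<in> N"
  shows "grad (c *\<^sub>R u) x = c *\<^sub>R grad u x"
proof (rule GDERIV_imp_grad_eq)
  have "GDERIV (\<lambda>x. c * u x) x :> c *\<^sub>R grad u x + u x *\<^sub>R 0"
    by (rule GDERIV_mult[OF GDERIV_const fe_GDERIV[OF assms]])
  then show "GDERIV (c *\<^sub>R u) x :> c *\<^sub>R grad u x"
    unfolding scaleR_fun_def by simp
qed

lemma fe_subspace: "subspace (fe r)"
proof (rule subspaceI)
  have "is_poly_on r K 0" for K :: "(real ^ 'n) set"
    unfolding is_poly_on_def by (rule exI[of _ "\<lambda>_. 0"]) simp
  moreover have "continuous_on (closure \<Omega>) (0 :: real ^ 'n \<Rightarrow> real)"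
    unfolding zero_fun_def by (rule continuous_on_const)
  ultimately show "0 \<in> fe r" by (simp add: fe_space_def)
next
  fix u v assume u: "u \<in> fe r" and v: "v \<in> fe r"
  have "is_poly_on r K (u + v)" if K: "K \<in> \<T>" for K
  proof -
    obtain a b :: "('n \<Rightarrow> nat) \<Rightarrow> real" where
      "\<forall>x\<in>K. u x = (\<Sum>\<alpha> | (\<Sum>i\<in>UNIV. \<alpha> i) \<le> r. a \<alpha> * (\<Prod>i\<in>UNIV. (x $ i) ^ \<alpha> i))"
      "\<forall>x\<in>K. v x = (\<Sum>\<alpha> | (\<Sum>i\<in>UNIV. \<alpha> i) \<le> r. b \<alpha> * (\<Prod>i\<in>UNIV. (x $ i) ^ \<alpha> i))"
      using u v K unfolding fe_space_def is_poly_on_def by blast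
    then show ?thesis
      unfolding is_poly_on_def
      by (intro exI[of _ "\<lambda>\<alpha>. a \<alpha> + b \<alpha>"]) (simp add: distrib_right sum.distrib)
  qed
  then show "u + v \<in> fe r"
    using u v continuous_on_add[of "closure \<Omega>" u v] by (simp add: fe_space_def plus_fun_def)
next
  fix c u assume u: "u \<in> fe r"
  have "is_poly_on r K (c *\<^sub>R u)" if K: "K \<in> \<T>" for K
  proof -
    obtain a :: "('n \<Rightarrow> nat) \<Rightarrow> real" where
      "\<forall>x\<in>K. u x = (\<Sum>\<alpha> | (\<Sum>i\<in>UNIV. \<alpha> i) \<le> r. a \<alpha> * (\<Prod>i\<in>UNIV. (x $ i) ^ \<alpha> i))"
      using u K unfolding fe_space_def is_poly_on_def by blast
    then show ?thesis
      unfolding is_poly_on_def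
      by (intro exI[of _ "\<lambda>\<alpha>. c * a \<alpha>"]) (simp add: sum_distrib_left mult.assoc)
  qed
  then show "c *\<^sub>R u \<in> fe r"
    using u continuous_on_mult[OF continuous_on_const, of "closure \<Omega>" u c]
    by (simp add: fe_space_def scaleR_fun_def)
qed

lemmas fe_closed = subspace_0[OF fe_subspace] subspace_add[OF fe_subspace]
  subspace_diff[OF fe_subspace] subspace_scale[OF fe_subspace] subspace_sum[OF fe_subspace]

text \<open>
  Constants, in the representation of discrete functions by extension with \<open>0\<close>.
\<close>
definition const_fe :: "real \<Rightarrow> real ^ 'n \<Rightarrow> real" where
  "const_fe c x = (if x \<in> closure \<Omega> then c else 0)"

lemma const_fe_in: "const_fe c \<in> fe r"
proof -
  have "is_poly_on r K (const_fe c)" if "K \<in> \<T>" for K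
    unfolding is_poly_on_def
  proof (intro exI[of _ "\<lambda>\<alpha>. if \<alpha> = (\<lambda>_. 0) then c else 0"] ballI)
    fix x assume "x \<in> K"
    then have x: "x \<in> closure \<Omega>" using that Union_mesh by blast
    have "(\<Sum>\<alpha> | (\<Sum>i\<in>UNIV. \<alpha> i) \<le> r. (if \<alpha> = (\<lambda>_. 0) then c else 0) * (\<Prod>i\<in>UNIV. (x $ i) ^ \<alpha> i))
      = (\<Sum>\<alpha> :: 'n \<Rightarrow> nat | (\<Sum>i\<in>UNIV. \<alpha> i) \<le> r. if \<alpha> = (\<lambda>_. 0) then c else 0)"
      by (rule sum.cong) auto
    also have "\<dots> = c" by (simp add: sum.delta[OF finite_multi_indices])
    finally show "const_fe c x = (\<Sum>\<alpha> | (\<Sum>i\<in>UNIV. \<alpha> i) \<le> r.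
        (if \<alpha> = (\<lambda>_. 0) then c else 0) * (\<Prod>i\<in>UNIV. (x $ i) ^ \<alpha> i))"
      using x by (simp add: const_fe_def)
  qed
  moreover have "continuous_on (closure \<Omega>) (const_fe c)"
    by (rule continuous_on_eq[of _ "\<lambda>_. c"]) (auto simp: const_fe_def)
  ultimately show ?thesis by (auto simp: fe_space_def const_fe_def)
qed

lemma const_fe_N: "x \<in> N \<Longrightarrow> const_fe c x = c"
  using N_subset by (auto simp: const_fe_def)

lemma grad_const_fe:
  assumes "x \<in> N"
  shows "grad (const_fe c) x = 0"
proof (rule GDERIV_imp_grad_eq, unfold gderiv_def,
    rule has_derivative_transform_within_open[OF _ open_N assms])
  show "((\<lambda>_. c) has_derivative (\<lambda>h. h \<bullet> 0)) (at x)" by simp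
qed (simp add: const_fe_N)

text \<open>
  Each element is the closure of its interior, so values on the open elements determine a continuous
  function on \<open>closure \<Omega>\<close>.
\<close>
lemma fe_eqI:
  assumes u: "u \<in> fe r" and v: "v \<in> fe s" and eq: "\<And>x. x \<in> N \<Longrightarrow> u x = v x"
  shows "u = v"
proof
  fix x
  show "u x = v x"
  proof (cases "x \<in> closure \<Omega>")
    case True
    then obtain K where K: "K \<in> \<T>" "x \<in> K" using Union_mesh by blast
    have "continuous_on K u" "continuous_on K v"
      using fe_continuous[OF u] fe_continuous[OF v] K Union_mesh continuous_on_subset by blast+
    then have "continuous_on (closure (interior K)) (\<lambda>x. u x - v x)"
      using element(4)[OF K(1)] by (simp add: continuous_on_diff)
    moreover have "u y - v y = 0" if "y \<in> interior K" for y
      using eq[of y] that K(1) by (auto simp: N_def)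
    ultimately have "u x - v x = 0"
      using continuous_constant_on_closure[of "interior K" "\<lambda>x. u x - v x" 0 x] element(4)[OF K(1)] K(2)
      by blast
    then show ?thesis by simp
  next
    case False
    then show ?thesis using u v by (simp add: fe_space_def)
  qed
qed

text \<open>
  The function is constant on each element, hence takes finitely many values on the connected set
  \<open>closure \<Omega>\<close>, on which it is continuous.
\<close>
lemma zero_gradient_imp_const:
  assumes v: "v \<in> fe r" and zero: "\<And>x. x \<in> N \<Longrightarrow> grad v x = 0"
  shows "\<exists>c. v = const_fe c"
proof -
  have "\<exists>c. \<forall>x\<in>K. v x = c" if K: "K \<in> \<T>" for K
  proof -
    have "\<exists>c. \<forall>x\<in>interior K. v x = c"
    proof (rule has_derivative_zero_constant)
      show "convex (interior K)" using element K by (simp add: convex_interior)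
      fix x assume "x \<in> interior K"
      then have "x \<in> N" using K by (auto simp: N_def)
      then show "(v has_derivative (\<lambda>h. 0)) (at x within interior K)"
        using fe_GDERIV[OF v] zero by (force simp: gderiv_def intro: has_derivative_at_withinI)
    qed
    then obtain c where c: "\<And>x. x \<in> interior K \<Longrightarrow> v x = c" by blast
    have "continuous_on K v"
      using fe_continuous[OF v] K Union_mesh continuous_on_subset by blast
    then show ?thesis
      using continuous_constant_on_closure[of "interior K" v c] c element(4)[OF K] by auto
  qed
  then obtain c where c: "\<And>K x. K \<in> \<T> \<Longrightarrow> x \<in> K \<Longrightarrow> v x = c K" by metis
  have "v ` closure \<Omega> \<subseteq> c ` \<T>" using c unfolding Union_mesh[symmetric] by auto
  then have "finite (v ` closure \<Omega>)" using finite_mesh finite_surj by blast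
  then have "v constant_on closure \<Omega>"
    using domain_basics(3) fe_continuous[OF v]
    by (intro continuous_finite_range_constant) (auto intro: connected_imp_connected_closure)
  then obtain k where "\<And>x. x \<in> closure \<Omega> \<Longrightarrow> v x = k" unfolding constant_on_def by blast
  then have "v = const_fe k" using v by (auto simp: fe_space_def const_fe_def)
  then show ?thesis ..
qed

section \<open>Forms and pressure\<close>

text \<open>
  All forms of the scheme are of this kind, with \<open>G\<close> the identity, the gradient, or the flux that
  belongs to a chemical potential.  Linearity of \<open>G\<close> can be asked only on the open elements, since
  gradients are unspecified elsewhere.
\<close>
lemma semi_inner_integral:
  fixes G :: "'v::real_vector \<Rightarrow> real ^ 'n \<Rightarrow> 'b::real_inner"
  assumes V: "subspace V" and bcont: "\<And>u. u \<in> V \<Longrightarrow> bcont N (G u)"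
    and add: "\<And>u v x. u \<in> V \<Longrightarrow> v \<in> V \<Longrightarrow> x \<in> N \<Longrightarrow> G (u + v) x = G u x + G v x"
    and scale: "\<And>c u x. u \<in> V \<Longrightarrow> x \<in> N \<Longrightarrow> G (c *\<^sub>R u) x = c *\<^sub>R G u x"
  shows "semi_inner V (\<lambda>u v. I (\<lambda>x. G u x \<bullet> G v x))"
proof
  show "subspace V" by fact
next
  fix u v show "I (\<lambda>x. G u x \<bullet> G v x) = I (\<lambda>x. G v x \<bullet> G u x)" by (simp add: inner_commute)
next
  fix u v w assume "u \<in> V" "v \<in> V" "w \<in> V"
  then show "I (\<lambda>x. G (u + v) x \<bullet> G w x) = I (\<lambda>x. G u x \<bullet> G w x) + I (\<lambda>x. G v x \<bullet> G w x)"
    by (subst I_add[symmetric]) (auto intro!: I_cong simp: bcont add inner_add_left)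
next
  fix u w c assume "u \<in> V" "w \<in> V"
  then show "I (\<lambda>x. G (c *\<^sub>R u) x \<bullet> G w x) = c * I (\<lambda>x. G u x \<bullet> G w x)"
    unfolding I_scale[symmetric] by (intro I_cong) (simp add: scale)
next
  fix u show "0 \<le> I (\<lambda>x. G u x \<bullet> G u x)" by (rule I_nonneg) simp
qed

lemma semi_inner_L2: "semi_inner (fe r) (\<lambda>u v. I (\<lambda>x. u x * v x))"
  using semi_inner_integral[of "fe r" "\<lambda>u. u"] fe_subspace by simp

lemma semi_inner_grad: "semi_inner (fe r) (\<lambda>u v. I (\<lambda>x. grad u x \<bullet> grad v x))"
  by (rule semi_inner_integral) (auto intro: fe_subspace fe_grad_bcont grad_add grad_scale)

lemma I_inner_self_zeroD:
  assumes "bcont N F" "I (\<lambda>x. F x \<bullet> F x) = 0" "x \<in> N"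
  shows "F x = 0"
proof -
  have "F x \<bullet> F x = 0"
    by (rule I_zeroD[where f = "\<lambda>x. F x \<bullet> F x"]) (use assms in auto)
  then show ?thesis by simp
qed

lemma L2_definite:
  assumes v: "v \<in> fe r" and z: "I (\<lambda>x. v x * v x) = 0"
  shows "v = 0"
proof (rule fe_eqI[OF v fe_closed(1)])
  fix x assume "x \<in> N"
  then show "v x = 0 x" using I_inner_self_zeroD[of v x] v z by simp
qed

lemma fe_zero_mean_iff:
  assumes v: "v \<in> fe r"
  shows "v \<in> L2_zero_mean \<Omega> \<longleftrightarrow> I v = 0"
proof -
  have "v \<in> borel_measurable (lebesgue_on \<Omega>)"
  proof (rule continuous_imp_measurable_on_sets_lebesgue)
    show "continuous_on \<Omega> v"
      using fe_continuous[OF v] closure_subset by (rule continuous_on_subset)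
    show "\<Omega> \<in> sets lebesgue" using domain_basics(2) by auto
  qed
  then have "set_borel_measurable lebesgue \<Omega> v"
    using domain_basics(2) by (simp add: set_borel_measurable_def borel_measurable_restrict_space_iff)
  moreover have "set_integrable lebesgue \<Omega> (\<lambda>x. (v x)\<^sup>2)"
    unfolding set_integrable_iff_N using v by (intro bcont_set_integrable_N bcont_power fe_bcont)
  moreover have "(LINT x:\<Omega>|lebesgue. v x) = I v"
    using v by (intro set_integral_eq_I fe_bcont)
  ultimately show ?thesis by (simp add: L2_zero_mean_def)
qed

lemma I_const_fe: "I (const_fe c) = c * I (\<lambda>x. 1)"
  unfolding I_scale[symmetric] by (rule I_cong) (simp add: const_fe_N)

text \<open>
  Assigning every point to one element that contains it writes a discrete function as a
  combination of monomials cut off to the assigned points.  These cut-off monomials are finite in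
  number but discontinuous; a subspace of their span nevertheless has a finite basis of its own.
\<close>
lemma fe_finitely_generated: "\<exists>S. finite S \<and> fe r = span S"
proof -
  define sel where "sel x = (SOME K. K \<in> \<T> \<and> x \<in> K)" for x
  have sel: "sel x \<in> \<T> \<and> x \<in> sel x" if "x \<in> closure \<Omega>" for x
    unfolding sel_def by (rule someI_ex) (use that Union_mesh in blast)
  define mi where "mi = {\<alpha> :: 'n \<Rightarrow> nat. (\<Sum>i\<in>UNIV. \<alpha> i) \<le> r}"
  define g where "g K \<alpha> x = (if x \<in> closure \<Omega> \<and> sel x = K then \<Prod>i\<in>UNIV. (x $ i) ^ \<alpha> i else 0)"
    for K and \<alpha> :: "'n \<Rightarrow> nat" and x :: "real ^ 'n"
  define G where "G = (\<lambda>(K, \<alpha>). g K \<alpha>) ` (\<T> \<times> mi)"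
  have finG: "finite G" unfolding G_def mi_def
    by (intro finite_imageI finite_cartesian_product finite_mesh finite_multi_indices)
  have sub: "fe r \<subseteq> span G"
  proof
    fix v assume v: "v \<in> fe r"
    then have "\<forall>K\<in>\<T>. \<exists>a. \<forall>x\<in>K. v x = (\<Sum>\<alpha>\<in>mi. a \<alpha> * (\<Prod>i\<in>UNIV. (x $ i) ^ \<alpha> i))"
      unfolding fe_space_def is_poly_on_def mi_def by blast
    then obtain a where a: "\<And>K x. K \<in> \<T> \<Longrightarrow> x \<in> K \<Longrightarrow>
        v x = (\<Sum>\<alpha>\<in>mi. a K \<alpha> * (\<Prod>i\<in>UNIV. (x $ i) ^ \<alpha> i))" by metis
    have "v x = (\<Sum>K\<in>\<T>. \<Sum>\<alpha>\<in>mi. a K \<alpha> *\<^sub>R g K \<alpha>) x" for x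
    proof (cases "x \<in> closure \<Omega>")
      case True
      have "(\<Sum>K\<in>\<T>. \<Sum>\<alpha>\<in>mi. a K \<alpha> *\<^sub>R g K \<alpha>) x
        = (\<Sum>K\<in>\<T>. if sel x = K then v x else 0)"
        unfolding sum_fun_apply
      proof (rule sum.cong[OF refl])
        fix K assume K: "K \<in> \<T>"
        show "(\<Sum>\<alpha>\<in>mi. (a K \<alpha> *\<^sub>R g K \<alpha>) x) = (if sel x = K then v x else 0)"
        proof (cases "sel x = K")
          case True
          then have "x \<in> K" using sel[OF \<open>x \<in> closure \<Omega>\<close>] by simp
          then show ?thesis using a[OF K] True \<open>x \<in> closure \<Omega>\<close> by (simp add: g_def)
        qed (simp add: g_def)
      qed
      then show ?thesis using sel[OF True] finite_mesh by simp
    next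
      case False
      then show ?thesis using v by (simp add: fe_space_def sum_fun_apply g_def)
    qed
    then have "v = (\<Sum>K\<in>\<T>. \<Sum>\<alpha>\<in>mi. a K \<alpha> *\<^sub>R g K \<alpha>)" by blast
    moreover have "g K \<alpha> \<in> span G" if "K \<in> \<T>" "\<alpha> \<in> mi" for K \<alpha>
      using that by (intro span_base) (auto simp: G_def)
    ultimately show "v \<in> span G" by (auto intro!: span_sum span_scale)
  qed
  obtain S where S: "S \<subseteq> fe r" "independent S" "fe r \<subseteq> span S"
    using maximal_independent_subset by blast
  have "finite S" using independent_span_bound[OF finG S(2)] S(1) sub by blast
  moreover have "fe r = span S" using S fe_subspace by (intro antisym span_minimal)
  ultimately show ?thesis by blast
qed

text \<open>
  A Neumann problem: the right-hand side \<open>q \<mapsto> - \<integral> G \<bullet> grad q\<close> does not see functions with zero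
  gradient, so it is representable, and adding a constant normalises the mean.  The difference of
  two solutions has zero gradient, hence is a constant of mean zero.
\<close>
lemma pressure_exists_unique:
  assumes G: "bcont N G"
  shows "\<exists>!p. p \<in> fe l \<inter> L2_zero_mean \<Omega> \<and> (\<forall>q\<in>fe l. I (\<lambda>x. (grad p x + G x) \<bullet> grad q x) = 0)"
proof -
  obtain S where S: "finite S" "fe l = span S" using fe_finitely_generated by blast
  interpret g: semi_inner "fe l" "\<lambda>u v. I (\<lambda>x. grad u x \<bullet> grad v x)" by (rule semi_inner_grad)
  define L where "L q = - I (\<lambda>x. G x \<bullet> grad q x)" for q
  have split: "I (\<lambda>x. (grad p x + G x) \<bullet> grad q x) = I (\<lambda>x. grad p x \<bullet> grad q x) - L q"
    if "p \<in> fe l" "q \<in> fe l" for p q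
    using that G by (simp add: L_def inner_add_left I_add)
  have "\<exists>u\<in>fe l. \<forall>v\<in>fe l. I (\<lambda>x. grad u x \<bullet> grad v x) = L v"
  proof (rule g.riesz_representation[OF S])
    fix u v assume uv: "u \<in> fe l" "v \<in> fe l"
    then have "I (\<lambda>x. G x \<bullet> grad (u + v) x) = I (\<lambda>x. G x \<bullet> grad u x) + I (\<lambda>x. G x \<bullet> grad v x)"
      using G by (subst I_add[symmetric]) (auto intro!: I_cong simp: grad_add inner_add_right)
    then show "L (u + v) = L u + L v" by (simp add: L_def)
  next
    fix c u assume u: "u \<in> fe l"
    then have "I (\<lambda>x. G x \<bullet> grad (c *\<^sub>R u) x) = c * I (\<lambda>x. G x \<bullet> grad u x)"
      unfolding I_scale[symmetric] by (intro I_cong) (simp add: grad_scale)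
    then show "L (c *\<^sub>R u) = c * L u" by (simp add: L_def)
  next
    fix u assume "u \<in> fe l" "I (\<lambda>x. grad u x \<bullet> grad u x) = 0"
    then have "grad u x = 0" if "x \<in> N" for x
      using I_inner_self_zeroD[OF fe_grad_bcont _ that] by blast
    then have "I (\<lambda>x. G x \<bullet> grad u x) = I (\<lambda>x. 0)" by (intro I_cong) simp
    then show "L u = 0" by (simp add: L_def)
  qed
  then obtain u where u: "u \<in> fe l" and uL: "\<And>v. v \<in> fe l \<Longrightarrow> I (\<lambda>x. grad u x \<bullet> grad v x) = L v"
    by blast
  define p where "p = u + const_fe (- I u / I (\<lambda>x. 1))"
  have p: "p \<in> fe l" unfolding p_def by (intro fe_closed u const_fe_in)
  have gp: "grad p x = grad u x" if "x \<in> N" for x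
    unfolding p_def using grad_add[OF u const_fe_in that] grad_const_fe[OF that] by simp
  have "I p = I u + I (const_fe (- I u / I (\<lambda>x. 1)))"
    unfolding p_def plus_fun_def using u const_fe_in by (intro I_add fe_bcont)
  then have "I p = 0" using I_one_pos unfolding I_const_fe by (simp del: lebesgue_integral_const)
  then have p0: "p \<in> L2_zero_mean \<Omega>" using fe_zero_mean_iff p by blast
  have eq: "I (\<lambda>x. (grad p x + G x) \<bullet> grad q x) = 0" if q: "q \<in> fe l" for q
  proof -
    have "I (\<lambda>x. grad p x \<bullet> grad q x) = I (\<lambda>x. grad u x \<bullet> grad q x)"
      by (rule I_cong) (simp add: gp)
    then show ?thesis using split[OF p q] uL[OF q] by simp
  qed
  show ?thesis
  proof (rule ex1I[of _ p])
    show "p \<in> fe l \<inter> L2_zero_mean \<Omega> \<and> (\<forall>q\<in>fe l. I (\<lambda>x. (grad p x + G x) \<bullet> grad q x) = 0)"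
      using p p0 eq by blast
  next
    fix p' assume p': "p' \<in> fe l \<inter> L2_zero_mean \<Omega> \<and> (\<forall>q\<in>fe l. I (\<lambda>x. (grad p' x + G x) \<bullet> grad q x) = 0)"
    then have p'1: "p' \<in> fe l" and "I p' = 0" using fe_zero_mean_iff by blast+
    define d where "d = p' - p"
    have d: "d \<in> fe l" unfolding d_def by (intro fe_closed p p'1)
    have "I (\<lambda>x. grad d x \<bullet> grad d x) = I (\<lambda>x. grad p' x \<bullet> grad d x) - I (\<lambda>x. grad p x \<bullet> grad d x)"
      using g.diff_left[OF p'1 p d] unfolding d_def .
    also have "\<dots> = 0" using split[OF p'1 d] split[OF p d] eq[OF d] p' d by auto
    finally have "grad d x = 0" if "x \<in> N" for x
      using I_inner_self_zeroD[OF fe_grad_bcont[OF d] _ that] by blast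
    then obtain c where c: "d = const_fe c" using zero_gradient_imp_const[OF d] by blast
    have "I d = I p' - I p"
      unfolding d_def fun_diff_def using p p'1 by (intro I_diff fe_bcont)
    then have "c * I (\<lambda>x. 1) = 0"
      using \<open>I p = 0\<close> \<open>I p' = 0\<close> unfolding c I_const_fe by simp
    then have "c = 0" using I_one_pos by (simp del: lebesgue_integral_const)
    then have "d = 0" unfolding c by (auto simp: const_fe_def fun_eq_iff)
    then show "p' = p" by (simp add: d_def)
  qed
qed

section \<open>The convex--concave energy\<close>

text \<open>
  The Ginzburg-Landau energy with its concave part linearised at \<open>\<phi>\<^sub>0\<close>.  This is what the choice
  \<open>\<phi>\<^sup>3 - \<phi>\<^sub>0\<close> of the nonlinearity means: it makes the chemical potential the derivative of a strictly
  convex functional, for every \<open>\<epsilon>\<close>.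
\<close>
definition energy :: "real \<Rightarrow> (real ^ 'n \<Rightarrow> real) \<Rightarrow> (real ^ 'n \<Rightarrow> real) \<Rightarrow> real" where
  "energy \<epsilon> \<phi>\<^sub>0 u = \<epsilon> / 2 * I (\<lambda>x. grad u x \<bullet> grad u x) + 1 / (4 * \<epsilon>) * I (\<lambda>x. u x ^ 4)
     - 1 / \<epsilon> * I (\<lambda>x. \<phi>\<^sub>0 x * u x)"

definition denergy ::
  "real \<Rightarrow> (real ^ 'n \<Rightarrow> real) \<Rightarrow> (real ^ 'n \<Rightarrow> real) \<Rightarrow> (real ^ 'n \<Rightarrow> real) \<Rightarrow> real" where
  "denergy \<epsilon> \<phi>\<^sub>0 u v = \<epsilon> * I (\<lambda>x. grad u x \<bullet> grad v x) + 1 / \<epsilon> * I (\<lambda>x. (u x ^ 3 - \<phi>\<^sub>0 x) * v x)"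

text \<open>
  The quartic term absorbs the linear one: \<open>a b \<le> a\<^sup>2 / 2 + b\<^sup>2 / 2\<close> and \<open>b\<^sup>2 / 2 \<le> (b\<^sup>4 + 1) / 4\<close>.
\<close>
lemma energy_bounded_below:
  assumes \<epsilon>: "0 < \<epsilon>" and \<phi>\<^sub>0: "\<phi>\<^sub>0 \<in> fe r" and u: "u \<in> fe r"
  shows "- (1 / \<epsilon> * I (\<lambda>x. 1 / 4 + 1 / 2 * \<phi>\<^sub>0 x ^ 2)) \<le> energy \<epsilon> \<phi>\<^sub>0 u"
proof -
  have young: "a * b \<le> 1 / 4 * b ^ 4 + (1 / 4 + 1 / 2 * a ^ 2)" for a b :: real
  proof -
    have "0 \<le> (a - b)\<^sup>2 / 2 + (b\<^sup>2 - 1)\<^sup>2 / 4" by simp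
    also have "\<dots> = 1 / 4 * b ^ 4 + (1 / 4 + 1 / 2 * a ^ 2) - a * b"
      by (simp add: power2_eq_square power4_eq_xxxx field_simps)
    finally show ?thesis by simp
  qed
  have "I (\<lambda>x. \<phi>\<^sub>0 x * u x) \<le> I (\<lambda>x. 1 / 4 * u x ^ 4 + (1 / 4 + 1 / 2 * \<phi>\<^sub>0 x ^ 2))"
    by (rule I_mono) (auto simp only: bcont_mult bcont_add bcont_const bcont_power fe_bcont[OF \<phi>\<^sub>0] fe_bcont[OF u] young)
  also have "\<dots> = 1 / 4 * I (\<lambda>x. u x ^ 4) + I (\<lambda>x. 1 / 4 + 1 / 2 * \<phi>\<^sub>0 x ^ 2)"
    by (subst I_add) (simp_all only: bcont_mult bcont_add bcont_const bcont_power fe_bcont[OF \<phi>\<^sub>0] fe_bcont[OF u] I_scale)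
  finally have "1 / \<epsilon> * I (\<lambda>x. \<phi>\<^sub>0 x * u x)
      \<le> 1 / \<epsilon> * (1 / 4 * I (\<lambda>x. u x ^ 4) + I (\<lambda>x. 1 / 4 + 1 / 2 * \<phi>\<^sub>0 x ^ 2))"
    using \<epsilon> by (intro mult_left_mono) auto
  moreover have "0 \<le> \<epsilon> / 2 * I (\<lambda>x. grad u x \<bullet> grad u x)"
    using \<epsilon> by (intro mult_nonneg_nonneg I_nonneg) auto
  moreover have "1 / \<epsilon> * (1 / 4 * a + b) = 1 / (4 * \<epsilon>) * a + 1 / \<epsilon> * b" for a b
    using \<epsilon> by (simp add: field_simps)
  note this[of "I (\<lambda>x. u x ^ 4)" "I (\<lambda>x. 1 / 4 + 1 / 2 * \<phi>\<^sub>0 x ^ 2)"]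
  ultimately show ?thesis unfolding energy_def by linarith
qed

text \<open>
  Along a line the energy is a polynomial of degree four, so the derivative is its linear
  coefficient.
\<close>
lemma energy_has_derivative:
  assumes \<epsilon>: "0 < \<epsilon>" and \<phi>\<^sub>0: "\<phi>\<^sub>0 \<in> fe r" and u: "u \<in> fe r" and v: "v \<in> fe r"
  shows "((\<lambda>s. energy \<epsilon> \<phi>\<^sub>0 (u + s *\<^sub>R v)) has_real_derivative denergy \<epsilon> \<phi>\<^sub>0 u v) (at 0)"
proof -
  interpret g: semi_inner "fe r" "\<lambda>u v. I (\<lambda>x. grad u x \<bullet> grad v x)" by (rule semi_inner_grad)
  note bc = bcont_mult bcont_add bcont_const bcont_power fe_bcont[OF \<phi>\<^sub>0] fe_bcont[OF u] fe_bcont[OF v]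
  define A where "A u v = I (\<lambda>x. grad u x \<bullet> grad v x)" for u v :: "real ^ 'n \<Rightarrow> real"
  define m where "m j k = I (\<lambda>x. u x ^ j * v x ^ k)" for j k
  have sv: "s *\<^sub>R v \<in> fe r" for s using fe_closed(4) v by blast
  have quadratic: "A (u + s *\<^sub>R v) (u + s *\<^sub>R v) = A u u + 2 * s * A u v + s\<^sup>2 * A v v" for s
    unfolding A_def using u v sv g.sym[OF v u]
    by (simp add: g.add_left g.add_right g.scale_left g.scale_right fe_closed power2_eq_square
        algebra_simps)
  have quartic: "I (\<lambda>x. (u + s *\<^sub>R v) x ^ 4)
      = I (\<lambda>x. u x ^ 4) + (4 * s * m 3 1 + (6 * s\<^sup>2 * m 2 2 + (4 * s ^ 3 * m 1 3 + s ^ 4 * m 0 4)))" for s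
  proof -
    have "I (\<lambda>x. (u + s *\<^sub>R v) x ^ 4) = I (\<lambda>x. u x ^ 4 + ((4 * s) * (u x ^ 3 * v x ^ 1)
        + ((6 * s\<^sup>2) * (u x ^ 2 * v x ^ 2) + ((4 * s ^ 3) * (u x ^ 1 * v x ^ 3) + s ^ 4 * (u x ^ 0 * v x ^ 4)))))"
      by (rule I_cong) (simp add: eval_nat_numeral algebra_simps)
    also have "\<dots> = I (\<lambda>x. u x ^ 4) + (4 * s * m 3 1 + (6 * s\<^sup>2 * m 2 2 + (4 * s ^ 3 * m 1 3 + s ^ 4 * m 0 4)))"
      unfolding m_def I_scale[symmetric] by (simp only: I_add bc)
    finally show ?thesis .
  qed
  have lin: "I (\<lambda>x. \<phi>\<^sub>0 x * (u + s *\<^sub>R v) x) = I (\<lambda>x. \<phi>\<^sub>0 x * u x) + s * I (\<lambda>x. \<phi>\<^sub>0 x * v x)" for s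
  proof -
    have "I (\<lambda>x. \<phi>\<^sub>0 x * (u + s *\<^sub>R v) x) = I (\<lambda>x. \<phi>\<^sub>0 x * u x + s * (\<phi>\<^sub>0 x * v x))"
      by (rule I_cong) (simp add: algebra_simps)
    then show ?thesis unfolding I_scale[symmetric] by (simp only: I_add bc)
  qed
  have split: "I (\<lambda>x. (u x ^ 3 - \<phi>\<^sub>0 x) * v x) = m 3 1 - I (\<lambda>x. \<phi>\<^sub>0 x * v x)"
    unfolding m_def by (subst I_diff[symmetric]) (auto intro!: I_cong simp: bc algebra_simps)
  have expand: "energy \<epsilon> \<phi>\<^sub>0 (u + s *\<^sub>R v) = \<epsilon> / 2 * (A u u + 2 * s * A u v + s\<^sup>2 * A v v)
      + 1 / (4 * \<epsilon>) * (I (\<lambda>x. u x ^ 4) + (4 * s * m 3 1 + (6 * s\<^sup>2 * m 2 2 + (4 * s ^ 3 * m 1 3 + s ^ 4 * m 0 4))))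
      - 1 / \<epsilon> * (I (\<lambda>x. \<phi>\<^sub>0 x * u x) + s * I (\<lambda>x. \<phi>\<^sub>0 x * v x))" for s
    unfolding energy_def A_def[symmetric] quadratic quartic lin ..
  have D: "denergy \<epsilon> \<phi>\<^sub>0 u v = \<epsilon> * A u v + 1 / \<epsilon> * (m 3 1 - I (\<lambda>x. \<phi>\<^sub>0 x * v x))"
    unfolding denergy_def A_def split ..
  have poly: "((\<lambda>s. \<epsilon> / 2 * (a + 2 * s * b + s\<^sup>2 * c)
      + 1 / (4 * \<epsilon>) * (d + (4 * s * e + (6 * s\<^sup>2 * f + (4 * s ^ 3 * g + s ^ 4 * h))))
      - 1 / \<epsilon> * (k + s * l)) has_real_derivative \<epsilon> * b + 1 / \<epsilon> * (e - l)) (at 0)"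
    for a b c d e f g h k l
    using \<epsilon> by (auto intro!: derivative_eq_intros simp: field_simps)
  show ?thesis unfolding expand D by (rule poly)
qed

lemma denergy_add:
  assumes "\<phi>\<^sub>0 \<in> fe r" "u \<in> fe r" "v \<in> fe r" "w \<in> fe r"
  shows "denergy \<epsilon> \<phi>\<^sub>0 u (v + w) = denergy \<epsilon> \<phi>\<^sub>0 u v + denergy \<epsilon> \<phi>\<^sub>0 u w"
proof -
  interpret g: semi_inner "fe r" "\<lambda>u v. I (\<lambda>x. grad u x \<bullet> grad v x)" by (rule semi_inner_grad)
  note bc = bcont_mult bcont_diff bcont_power fe_bcont[OF assms(1)] fe_bcont[OF assms(2)]
    fe_bcont[OF assms(3)] fe_bcont[OF assms(4)]
  have "I (\<lambda>x. (u x ^ 3 - \<phi>\<^sub>0 x) * (v + w) x)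
      = I (\<lambda>x. (u x ^ 3 - \<phi>\<^sub>0 x) * v x) + I (\<lambda>x. (u x ^ 3 - \<phi>\<^sub>0 x) * w x)"
    by (subst I_add[symmetric]) (auto intro!: I_cong simp: bc algebra_simps)
  then show ?thesis
    unfolding denergy_def using g.add_right[OF assms(3,4,2)] by (simp add: distrib_left)
qed

lemma denergy_scale:
  assumes "u \<in> fe r" "v \<in> fe r"
  shows "denergy \<epsilon> \<phi>\<^sub>0 u (c *\<^sub>R v) = c * denergy \<epsilon> \<phi>\<^sub>0 u v"
proof -
  interpret g: semi_inner "fe r" "\<lambda>u v. I (\<lambda>x. grad u x \<bullet> grad v x)" by (rule semi_inner_grad)
  have "I (\<lambda>x. (u x ^ 3 - \<phi>\<^sub>0 x) * (c *\<^sub>R v) x) = c * I (\<lambda>x. (u x ^ 3 - \<phi>\<^sub>0 x) * v x)"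
    unfolding I_scale[symmetric] by (rule I_cong) (simp add: algebra_simps)
  then show ?thesis
    unfolding denergy_def using g.scale_right[OF assms(2,1), of c] by (simp add: algebra_simps)
qed

text \<open>
  The cubic alone decides: where \<open>(u\<^sup>3 - v\<^sup>3) (u - v)\<close> vanishes, \<open>u = v\<close>.  The gradient term cannot
  separate functions that differ by a constant.
\<close>
lemma denergy_strictly_monotone:
  assumes \<epsilon>: "0 < \<epsilon>" and \<phi>\<^sub>0: "\<phi>\<^sub>0 \<in> fe r" and u: "u \<in> fe r" and v: "v \<in> fe r"
    and le: "denergy \<epsilon> \<phi>\<^sub>0 u (u - v) - denergy \<epsilon> \<phi>\<^sub>0 v (u - v) \<le> 0"
  shows "u = v"
proof -
  interpret g: semi_inner "fe r" "\<lambda>u v. I (\<lambda>x. grad u x \<bullet> grad v x)" by (rule semi_inner_grad)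
  have d: "u - v \<in> fe r" using u v fe_closed(3) by blast
  note bc = bcont_mult bcont_diff bcont_power fe_bcont[OF \<phi>\<^sub>0] fe_bcont[OF u] fe_bcont[OF v]
  define C where "C = I (\<lambda>x. (u x ^ 3 - v x ^ 3) * (u x - v x))"
  have "I (\<lambda>x. (u x ^ 3 - \<phi>\<^sub>0 x) * (u - v) x) - I (\<lambda>x. (v x ^ 3 - \<phi>\<^sub>0 x) * (u - v) x) = C"
    unfolding C_def minus_apply
    by (subst I_diff[symmetric]) (auto intro!: I_cong simp: bc algebra_simps)
  then have "denergy \<epsilon> \<phi>\<^sub>0 u (u - v) - denergy \<epsilon> \<phi>\<^sub>0 v (u - v)
      = \<epsilon> * I (\<lambda>x. grad (u - v) x \<bullet> grad (u - v) x) + 1 / \<epsilon> * C"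
    unfolding denergy_def g.diff_left[OF u v d] right_diff_distrib[of \<epsilon>]
    by (simp only: right_diff_distrib[symmetric] add_diff_add)
  moreover have "0 \<le> \<epsilon> * I (\<lambda>x. grad (u - v) x \<bullet> grad (u - v) x)"
    using \<epsilon> by (intro mult_nonneg_nonneg I_nonneg) auto
  ultimately have "1 / \<epsilon> * C \<le> 0" using le by linarith
  then have "C \<le> 0" using \<epsilon> by (simp add: divide_le_0_iff)
  moreover have "0 \<le> C" unfolding C_def by (rule I_nonneg) (rule cube_monotone)
  ultimately have C0: "C = 0" by simp
  show ?thesis
  proof (rule fe_eqI[OF u v])
    fix x assume x: "x \<in> N"
    have "(u x ^ 3 - v x ^ 3) * (u x - v x) = 0"
      by (rule I_zeroD[where f = "\<lambda>x. (u x ^ 3 - v x ^ 3) * (u x - v x)"])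
        (use C0 x cube_monotone in \<open>auto simp: bc C_def\<close>)
    then show "u x = v x" by (rule cube_strictly_monotone)
  qed
qed

text \<open>
  The integral is a polynomial in the coordinates.  Peeling off one factor of the power at a time
  turns this into an induction in which the weight \<open>h\<close> collects the factors.
\<close>
lemma continuous_on_integral_power:
  fixes g :: "'i \<Rightarrow> real ^ 'n \<Rightarrow> real"
  assumes J: "\<And>i. i \<in> J \<Longrightarrow> bcont N (g i)" and f: "bcont N f" and h: "bcont N h"
  shows "continuous_on UNIV (\<lambda>y::'i \<Rightarrow> real. I (\<lambda>x. h x * (f x + (\<Sum>i\<in>J. y i * g i x)) ^ k))"
  using h
proof (induction k arbitrary: h)
  case 0
  then show ?case by simp
next
  case (Suc k)
  have sum_bc: "bcont N (\<lambda>x. \<Sum>i\<in>J'. y i * F i x)" if "\<And>i. i \<in> J' \<Longrightarrow> bcont N (F i)"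
    for J' and y :: "'i \<Rightarrow> real" and F :: "'i \<Rightarrow> real ^ 'n \<Rightarrow> real"
    using that by (induction J' rule: infinite_finite_induct) auto
  have I_sum: "I (\<lambda>x. \<Sum>i\<in>J'. y i * F i x) = (\<Sum>i\<in>J'. y i * I (F i))" if "\<And>i. i \<in> J' \<Longrightarrow> bcont N (F i)"
    for J' and y :: "'i \<Rightarrow> real" and F :: "'i \<Rightarrow> real ^ 'n \<Rightarrow> real"
    using that
  proof (induction J' rule: infinite_finite_induct)
    case (insert i J')
    then have "I (\<lambda>x. y i * F i x + (\<Sum>i\<in>J'. y i * F i x)) = I (\<lambda>x. y i * F i x) + I (\<lambda>x. \<Sum>i\<in>J'. y i * F i x)"
      by (intro I_add sum_bc) auto
    then show ?case using insert by simp
  qed auto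
  define \<Phi> where "\<Phi> y x = f x + (\<Sum>i\<in>J. y i * g i x)" for y x
  have \<Phi>: "bcont N (\<Phi> y)" for y
    unfolding \<Phi>_def using sum_bc[of J g y] J f by (intro bcont_add) auto
  have step: "I (\<lambda>x. h x * \<Phi> y x ^ Suc k)
      = I (\<lambda>x. (h x * f x) * \<Phi> y x ^ k) + (\<Sum>i\<in>J. y i * I (\<lambda>x. (h x * g i x) * \<Phi> y x ^ k))" for y
  proof -
    have "I (\<lambda>x. h x * \<Phi> y x ^ Suc k)
        = I (\<lambda>x. (h x * f x) * \<Phi> y x ^ k + (\<Sum>i\<in>J. y i * ((h x * g i x) * \<Phi> y x ^ k)))"
      by (rule I_cong) (simp add: \<Phi>_def sum_distrib_left sum_distrib_right algebra_simps)
    also have "\<dots> = I (\<lambda>x. (h x * f x) * \<Phi> y x ^ k) + I (\<lambda>x. \<Sum>i\<in>J. y i * ((h x * g i x) * \<Phi> y x ^ k))"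
      using Suc.prems f J \<Phi> by (intro I_add sum_bc bcont_mult bcont_power) auto
    also have "I (\<lambda>x. \<Sum>i\<in>J. y i * ((h x * g i x) * \<Phi> y x ^ k)) = (\<Sum>i\<in>J. y i * I (\<lambda>x. (h x * g i x) * \<Phi> y x ^ k))"
      using Suc.prems J \<Phi> by (intro I_sum bcont_mult bcont_power) auto
    finally show ?thesis .
  qed
  show ?case
    unfolding \<Phi>_def[symmetric] step
    unfolding \<Phi>_def
    by (intro continuous_intros continuous_on_product_coordinates Suc.IH bcont_mult f J Suc.prems)
qed

lemma continuous_on_energy:
  assumes \<phi>\<^sub>0: "\<phi>\<^sub>0 \<in> fe r" and g: "g ` J \<subseteq> fe r"
  shows "continuous_on UNIV (\<lambda>y::'i \<Rightarrow> real. energy \<epsilon> \<phi>\<^sub>0 (\<phi>\<^sub>0 + (\<Sum>i\<in>J. y i *\<^sub>R g i)))"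
proof -
  interpret g: semi_inner "fe r" "\<lambda>u v. I (\<lambda>x. grad u x \<bullet> grad v x)" by (rule semi_inner_grad)
  have gi: "g i \<in> fe r" if "i \<in> J" for i using that g by blast
  define \<Phi> where "\<Phi> y = \<phi>\<^sub>0 + (\<Sum>i\<in>J. y i *\<^sub>R g i)" for y
  have sV: "(\<Sum>i\<in>J. y i *\<^sub>R g i) \<in> fe r" for y
    by (intro fe_closed(5) fe_closed(4) gi)
  have \<Phi>: "\<Phi> y \<in> fe r" for y unfolding \<Phi>_def by (intro fe_closed(2) \<phi>\<^sub>0 sV)
  have apply_eq: "\<Phi> y x = \<phi>\<^sub>0 x + (\<Sum>i\<in>J. y i * g i x)" for y x
    by (simp add: \<Phi>_def sum_fun_apply)
  have lin: "I (\<lambda>x. grad (\<Phi> y) x \<bullet> grad v x)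
      = I (\<lambda>x. grad \<phi>\<^sub>0 x \<bullet> grad v x) + (\<Sum>i\<in>J. y i * I (\<lambda>x. grad (g i) x \<bullet> grad v x))"
    if v: "v \<in> fe r" for v y
    unfolding \<Phi>_def using g.add_left[OF \<phi>\<^sub>0 sV v] g.sum_left[OF gi v] by simp
  have lin_cont: "continuous_on UNIV (\<lambda>y. I (\<lambda>x. grad (\<Phi> y) x \<bullet> grad v x))" if "v \<in> fe r" for v
    unfolding lin[OF that] by (intro continuous_intros continuous_on_product_coordinates)
  have sq: "I (\<lambda>x. grad (\<Phi> y) x \<bullet> grad (\<Phi> y) x)
      = I (\<lambda>x. grad (\<Phi> y) x \<bullet> grad \<phi>\<^sub>0 x) + (\<Sum>i\<in>J. y i * I (\<lambda>x. grad (\<Phi> y) x \<bullet> grad (g i) x))" for y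
    using lin[OF \<Phi>, of y y] by (simp add: inner_commute)
  have "continuous_on UNIV (\<lambda>y. I (\<lambda>x. grad (\<Phi> y) x \<bullet> grad (\<Phi> y) x))"
    unfolding sq by (intro continuous_intros continuous_on_product_coordinates lin_cont \<phi>\<^sub>0 gi)
  moreover have "continuous_on UNIV (\<lambda>y. I (\<lambda>x. \<Phi> y x ^ 4))"
    using continuous_on_integral_power[OF fe_bcont[OF gi] fe_bcont[OF \<phi>\<^sub>0] bcont_const[of N 1], where J = J and k = 4]
    by (simp add: apply_eq)
  moreover have "continuous_on UNIV (\<lambda>y. I (\<lambda>x. \<phi>\<^sub>0 x * \<Phi> y x))"
    using continuous_on_integral_power[OF fe_bcont[OF gi] fe_bcont[OF \<phi>\<^sub>0] fe_bcont[OF \<phi>\<^sub>0], where J = J and k = 1]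
    by (simp add: apply_eq)
  ultimately show ?thesis
    unfolding energy_def \<Phi>_def[symmetric] by (intro continuous_intros)
qed

section \<open>One time step\<close>

text \<open>
  The equations of the scheme, with every inner product moved from \<open>\<Omega>\<close> to the open elements.
\<close>
lemma scheme_step_iff:
  fixes \<gamma> \<epsilon> \<tau> :: real
  assumes \<phi>\<^sub>0: "\<phi>\<^sub>0 \<in> fe r" and p: "p \<in> fe l" and \<mu>: "\<mu> \<in> fe r" and \<phi>: "\<phi> \<in> fe r"
  defines "F \<equiv> \<lambda>x. grad p x + (\<gamma> * \<phi>\<^sub>0 x) *\<^sub>R grad \<mu> x"
  shows "scheme_step \<Omega> (fe r) (fe l) \<gamma> \<epsilon> \<tau> \<phi>\<^sub>0 p \<mu> \<phi> \<longleftrightarrow>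
    (\<forall>q\<in>fe l. I (\<lambda>x. F x \<bullet> grad q x) = 0) \<and>
    (\<forall>\<nu>\<in>fe r. 1 / \<tau> * I (\<lambda>x. (\<phi> - \<phi>\<^sub>0) x * \<nu> x) + \<epsilon> * I (\<lambda>x. grad \<mu> x \<bullet> grad \<nu> x)
        + I (\<lambda>x. \<phi>\<^sub>0 x * (F x \<bullet> grad \<nu> x)) = 0) \<and>
    (\<forall>\<psi>\<in>fe r. I (\<lambda>x. \<mu> x * \<psi> x) = denergy \<epsilon> \<phi>\<^sub>0 \<phi> \<psi>)"
proof -
  note bc = fe_bcont[OF \<phi>\<^sub>0] fe_bcont[OF \<mu>] fe_bcont[OF \<phi>] fe_grad_bcont[OF p] fe_grad_bcont[OF \<mu>]
    fe_grad_bcont[OF \<phi>]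
  have F: "bcont N F" unfolding F_def using bc by simp
  have e1: "L2_inner \<Omega> F (grad q) = I (\<lambda>x. F x \<bullet> grad q x)" if "q \<in> fe l" for q
    using F that by (intro L2_inner_eq_I bcont_inner fe_grad_bcont)
  have e2: "L2_inner \<Omega> (\<lambda>x. (\<phi> x - \<phi>\<^sub>0 x) / \<tau>) \<nu> = 1 / \<tau> * I (\<lambda>x. (\<phi> - \<phi>\<^sub>0) x * \<nu> x)"
    if \<nu>: "\<nu> \<in> fe r" for \<nu>
  proof -
    have "bcont N (\<lambda>x. 1 / \<tau> * (\<phi> x - \<phi>\<^sub>0 x) * \<nu> x)"
      by (intro bcont_mult bcont_diff bcont_const bc fe_bcont[OF \<nu>])
    then have "L2_inner \<Omega> (\<lambda>x. (\<phi> x - \<phi>\<^sub>0 x) / \<tau>) \<nu> = I (\<lambda>x. (\<phi> x - \<phi>\<^sub>0 x) / \<tau> * \<nu> x)"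
      by (subst L2_inner_eq_I) simp_all
    then show ?thesis unfolding I_scale[symmetric] by simp
  qed
  have e3: "L2_inner \<Omega> (grad \<mu>) (grad \<nu>) = I (\<lambda>x. grad \<mu> x \<bullet> grad \<nu> x)"
    "L2_inner \<Omega> (grad \<phi>) (grad \<nu>) = I (\<lambda>x. grad \<phi> x \<bullet> grad \<nu> x)"
    "L2_inner \<Omega> \<mu> \<nu> = I (\<lambda>x. \<mu> x * \<nu> x)"
    "L2_inner \<Omega> (\<lambda>x. \<phi>\<^sub>0 x *\<^sub>R F x) (grad \<nu>) = I (\<lambda>x. \<phi>\<^sub>0 x * (F x \<bullet> grad \<nu> x))"
    "L2_inner \<Omega> (\<lambda>x. \<phi> x ^ 3 - \<phi>\<^sub>0 x) \<nu> = I (\<lambda>x. (\<phi> x ^ 3 - \<phi>\<^sub>0 x) * \<nu> x)"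
    if \<nu>: "\<nu> \<in> fe r" for \<nu>
    using F bc fe_bcont[OF \<nu>] fe_grad_bcont[OF \<nu>] by (subst L2_inner_eq_I; simp)+
  have F_apply: "grad p x + (\<gamma> * \<phi>\<^sub>0 x) *\<^sub>R grad \<mu> x = F x" for x
    by (simp add: F_def)
  show ?thesis
    unfolding scheme_step_def F_apply denergy_def
    by (auto simp: e1 e2 e3 simp del: minus_apply)
qed

text \<open>
  The pressure is a linear function \<open>Pr \<mu>\<close> of the chemical potential.  Write
  \<open>F \<mu> = grad (Pr \<mu>) + \<gamma> \<phi>\<^sub>0 grad \<mu>\<close> for the flux.  It is orthogonal to gradients of pressures, so
  \<open>\<integral> \<phi>\<^sub>0 F \<mu> \<bullet> grad \<nu> = (1 / \<gamma>) \<integral> F \<mu> \<bullet> F \<nu>\<close>: the convective term is a symmetric nonnegative form.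
  After elimination of the pressure the step is therefore an implicit gradient step.
\<close>
theorem scheme_step_unique_solvability:
  assumes \<phi>\<^sub>0: "\<phi>\<^sub>0 \<in> fe r" and \<gamma>: "0 < \<gamma>" and \<epsilon>: "0 < \<epsilon>" and \<tau>: "0 < \<tau>"
  shows "\<exists>!u. u \<in> (fe l \<inter> L2_zero_mean \<Omega>) \<times> fe r \<times> fe r \<and>
           (case u of (p, \<mu>, \<phi>) \<Rightarrow> scheme_step \<Omega> (fe r) (fe l) \<gamma> \<epsilon> \<tau> \<phi>\<^sub>0 p \<mu> \<phi>)"
proof -
  define G where "G \<mu> x = (\<gamma> * \<phi>\<^sub>0 x) *\<^sub>R grad \<mu> x" for \<mu> x
  have G: "bcont N (G \<mu>)" if "\<mu> \<in> fe r" for \<mu>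
    unfolding G_def using that \<phi>\<^sub>0 by simp
  define is_pressure where "is_pressure \<mu> p \<longleftrightarrow> p \<in> fe l \<inter> L2_zero_mean \<Omega> \<and>
      (\<forall>q\<in>fe l. I (\<lambda>x. (grad p x + G \<mu> x) \<bullet> grad q x) = 0)" for \<mu> p
  have ex1: "\<exists>!p. is_pressure \<mu> p" if "\<mu> \<in> fe r" for \<mu>
    unfolding is_pressure_def using pressure_exists_unique[OF G[OF that]] .
  define Pr where "Pr \<mu> = (THE p. is_pressure \<mu> p)" for \<mu>
  have Pr: "is_pressure \<mu> (Pr \<mu>)" if "\<mu> \<in> fe r" for \<mu>
    unfolding Pr_def using theI'[OF ex1[OF that]] .
  have Pr_eq: "Pr \<mu> = p" if "\<mu> \<in> fe r" "is_pressure \<mu> p" for \<mu> p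
    using ex1[OF that(1)] Pr[OF that(1)] that(2) by blast
  have Pr_fe: "Pr \<mu> \<in> fe l" if "\<mu> \<in> fe r" for \<mu>
    using Pr[OF that] by (simp add: is_pressure_def)
  \<comment> \<open>Linearity of \<open>Pr\<close> comes from uniqueness: the combination of pressures solves the combined problem.\<close>
  have combine: "is_pressure (c *\<^sub>R \<mu> + \<nu>) (c *\<^sub>R Pr \<mu> + Pr \<nu>)" if \<mu>: "\<mu> \<in> fe r" and \<nu>: "\<nu> \<in> fe r" for c \<mu> \<nu>
  proof -
    have in_fe: "c *\<^sub>R Pr \<mu> + Pr \<nu> \<in> fe l" by (intro fe_closed Pr_fe \<mu> \<nu>)
    have "I (Pr \<mu>) = 0" "I (Pr \<nu>) = 0"
      using Pr[OF \<mu>] Pr[OF \<nu>] fe_zero_mean_iff unfolding is_pressure_def by blast+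
    moreover have "I (c *\<^sub>R Pr \<mu> + Pr \<nu>) = c * I (Pr \<mu>) + I (Pr \<nu>)"
      using I_add[of "\<lambda>x. c * Pr \<mu> x" "Pr \<nu>"] Pr_fe[OF \<mu>] Pr_fe[OF \<nu>]
      by (simp add: plus_fun_def scaleR_fun_def)
    ultimately have "c *\<^sub>R Pr \<mu> + Pr \<nu> \<in> L2_zero_mean \<Omega>"
      using fe_zero_mean_iff[OF in_fe] by simp
    moreover have "I (\<lambda>x. (grad (c *\<^sub>R Pr \<mu> + Pr \<nu>) x + G (c *\<^sub>R \<mu> + \<nu>) x) \<bullet> grad q x) = 0"
      if q: "q \<in> fe l" for q
    proof -
      have "I (\<lambda>x. (grad (c *\<^sub>R Pr \<mu> + Pr \<nu>) x + G (c *\<^sub>R \<mu> + \<nu>) x) \<bullet> grad q x)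
          = I (\<lambda>x. c * ((grad (Pr \<mu>) x + G \<mu> x) \<bullet> grad q x) + (grad (Pr \<nu>) x + G \<nu> x) \<bullet> grad q x)"
      proof (rule I_cong)
        fix x assume x: "x \<in> N"
        show "(grad (c *\<^sub>R Pr \<mu> + Pr \<nu>) x + G (c *\<^sub>R \<mu> + \<nu>) x) \<bullet> grad q x
          = c * ((grad (Pr \<mu>) x + G \<mu> x) \<bullet> grad q x) + (grad (Pr \<nu>) x + G \<nu> x) \<bullet> grad q x"
          unfolding G_def grad_add[OF fe_closed(4)[OF Pr_fe[OF \<mu>]] Pr_fe[OF \<nu>] x]
            grad_add[OF fe_closed(4)[OF \<mu>] \<nu> x] grad_scale[OF Pr_fe[OF \<mu>] x] grad_scale[OF \<mu> x]
          by (simp add: algebra_simps inner_add_left)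
      qed
      also have "\<dots> = c * I (\<lambda>x. (grad (Pr \<mu>) x + G \<mu> x) \<bullet> grad q x)
          + I (\<lambda>x. (grad (Pr \<nu>) x + G \<nu> x) \<bullet> grad q x)"
        unfolding I_scale[symmetric]
        by (intro I_add bcont_mult bcont_const bcont_inner bcont_add G fe_grad_bcont[OF Pr_fe]
            fe_grad_bcont[OF q] \<mu> \<nu>)
      also have "\<dots> = 0" using Pr[OF \<mu>] Pr[OF \<nu>] q unfolding is_pressure_def by simp
      finally show ?thesis .
    qed
    ultimately show ?thesis using in_fe unfolding is_pressure_def by blast
  qed
  have Pr_lin: "Pr (c *\<^sub>R \<mu> + \<nu>) = c *\<^sub>R Pr \<mu> + Pr \<nu>" if "\<mu> \<in> fe r" "\<nu> \<in> fe r" for c \<mu> \<nu>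
    by (rule Pr_eq[OF _ combine[OF that]]) (intro fe_closed that)
  have Pr_add: "Pr (\<mu> + \<nu>) = Pr \<mu> + Pr \<nu>" if "\<mu> \<in> fe r" "\<nu> \<in> fe r" for \<mu> \<nu>
    using Pr_lin[OF that, of 1] by simp
  have "Pr 0 = 0" using Pr_lin[OF fe_closed(1) fe_closed(1), of 1] by simp
  then have Pr_scale: "Pr (c *\<^sub>R \<mu>) = c *\<^sub>R Pr \<mu>" if "\<mu> \<in> fe r" for c \<mu>
    using Pr_lin[OF that fe_closed(1), of c] by simp
  define F where "F \<mu> x = grad (Pr \<mu>) x + G \<mu> x" for \<mu> x
  have F: "bcont N (F \<mu>)" if "\<mu> \<in> fe r" for \<mu>
    unfolding F_def using G[OF that] Pr_fe[OF that] by simp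
  have F_orth: "I (\<lambda>x. F \<mu> x \<bullet> grad q x) = 0" if "\<mu> \<in> fe r" "q \<in> fe l" for \<mu> q
    using Pr[OF that(1)] that(2) unfolding is_pressure_def F_def by blast
  have "semi_inner (fe r) (\<lambda>\<mu> \<nu>. I (\<lambda>x. F \<mu> x \<bullet> F \<nu> x))"
  proof (rule semi_inner_integral[OF fe_subspace F])
    fix u v x assume u: "u \<in> fe r" and v: "v \<in> fe r" and x: "x \<in> N"
    show "F (u + v) x = F u x + F v x"
      unfolding F_def G_def Pr_add[OF u v] grad_add[OF u v x] grad_add[OF Pr_fe[OF u] Pr_fe[OF v] x]
      by (simp add: algebra_simps)
  next
    fix c u x assume u: "u \<in> fe r" and x: "x \<in> N"
    show "F (c *\<^sub>R u) x = c *\<^sub>R F u x"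
      unfolding F_def G_def Pr_scale[OF u] grad_scale[OF u x] grad_scale[OF Pr_fe[OF u] x]
      by (simp add: algebra_simps)
  qed
  then have B_semi: "semi_inner (fe r)
      (\<lambda>\<mu> \<nu>. \<epsilon> * I (\<lambda>x. grad \<mu> x \<bullet> grad \<nu> x) + 1 / \<gamma> * I (\<lambda>x. F \<mu> x \<bullet> F \<nu> x))"
    using \<epsilon> \<gamma> by (intro semi_inner_combination semi_inner_grad) auto
  define B where "B \<mu> \<nu> = \<epsilon> * I (\<lambda>x. grad \<mu> x \<bullet> grad \<nu> x) + 1 / \<gamma> * I (\<lambda>x. F \<mu> x \<bullet> F \<nu> x)" for \<mu> \<nu>
  \<comment> \<open>Only the part \<open>\<gamma> \<phi>\<^sub>0 grad \<nu>\<close> of \<open>F \<nu>\<close> survives in the product with \<open>F \<mu>\<close>.\<close>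
  have transport: "I (\<lambda>x. \<phi>\<^sub>0 x * (F \<mu> x \<bullet> grad \<nu> x)) = 1 / \<gamma> * I (\<lambda>x. F \<mu> x \<bullet> F \<nu> x)"
    if \<mu>: "\<mu> \<in> fe r" and \<nu>: "\<nu> \<in> fe r" for \<mu> \<nu>
  proof -
    have "I (\<lambda>x. F \<mu> x \<bullet> F \<nu> x)
        = I (\<lambda>x. F \<mu> x \<bullet> grad (Pr \<nu>) x + \<gamma> * (\<phi>\<^sub>0 x * (F \<mu> x \<bullet> grad \<nu> x)))"
      by (rule I_cong) (simp add: F_def[of \<nu>] G_def inner_add_right)
    also have "\<dots> = I (\<lambda>x. F \<mu> x \<bullet> grad (Pr \<nu>) x) + I (\<lambda>x. \<gamma> * (\<phi>\<^sub>0 x * (F \<mu> x \<bullet> grad \<nu> x)))"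
      by (intro I_add bcont_mult bcont_const bcont_inner F \<mu> fe_bcont[OF \<phi>\<^sub>0] fe_grad_bcont[OF \<nu>]
          fe_grad_bcont[OF Pr_fe[OF \<nu>]])
    also have "\<dots> = \<gamma> * I (\<lambda>x. \<phi>\<^sub>0 x * (F \<mu> x \<bullet> grad \<nu> x))"
      using F_orth[OF \<mu> Pr_fe[OF \<nu>]] unfolding I_scale by simp
    finally show ?thesis using \<gamma> by simp
  qed
  obtain S where S: "finite S" "fe r = span S" using fe_finitely_generated by blast
  define reduced where "reduced \<mu> \<phi> \<longleftrightarrow> \<mu> \<in> fe r \<and> \<phi> \<in> fe r \<and>
      (\<forall>\<nu>\<in>fe r. I (\<lambda>x. (\<phi> - \<phi>\<^sub>0) x * \<nu> x) + \<tau> * B \<mu> \<nu> = 0) \<and>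
      (\<forall>\<psi>\<in>fe r. I (\<lambda>x. \<mu> x * \<psi> x) = denergy \<epsilon> \<phi>\<^sub>0 \<phi> \<psi>)" for \<mu> \<phi>
  have "\<exists>!(\<mu>, \<phi>). reduced \<mu> \<phi>"
    unfolding reduced_def
  proof (rule implicit_gradient_step[OF semi_inner_L2 L2_definite _ S \<phi>\<^sub>0 \<tau>
        energy_bounded_below[OF \<epsilon> \<phi>\<^sub>0] energy_has_derivative[OF \<epsilon> \<phi>\<^sub>0] denergy_add[OF \<phi>\<^sub>0]
        denergy_scale continuous_on_energy[OF \<phi>\<^sub>0] denergy_strictly_monotone[OF \<epsilon> \<phi>\<^sub>0]])
    show "semi_inner (fe r) B" using B_semi by (simp add: B_def[abs_def])
  qed
  then obtain \<mu> \<phi> where red: "reduced \<mu> \<phi>"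
    and uniq: "\<And>\<mu>' \<phi>'. reduced \<mu>' \<phi>' \<Longrightarrow> \<mu>' = \<mu> \<and> \<phi>' = \<phi>"
    by (auto simp: Ex1_def)
  have iff: "(p \<in> fe l \<inter> L2_zero_mean \<Omega> \<and> \<mu> \<in> fe r \<and> \<phi> \<in> fe r \<and>
      scheme_step \<Omega> (fe r) (fe l) \<gamma> \<epsilon> \<tau> \<phi>\<^sub>0 p \<mu> \<phi>) \<longleftrightarrow> p = Pr \<mu> \<and> reduced \<mu> \<phi>" for p \<mu> \<phi>
  proof (cases "\<mu> \<in> fe r \<and> \<phi> \<in> fe r")
    case True
    then have \<mu>: "\<mu> \<in> fe r" and \<phi>: "\<phi> \<in> fe r" by auto
    have "p = Pr \<mu>" if "p \<in> fe l \<inter> L2_zero_mean \<Omega>" "scheme_step \<Omega> (fe r) (fe l) \<gamma> \<epsilon> \<tau> \<phi>\<^sub>0 p \<mu> \<phi>"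
    proof -
      have "p \<in> fe l" using that(1) by simp
      then have "is_pressure \<mu> p"
        using that scheme_step_iff[OF \<phi>\<^sub>0 _ \<mu> \<phi>, of p l] unfolding is_pressure_def G_def by blast
      then show ?thesis using Pr_eq[OF \<mu>] by simp
    qed
    moreover have "scheme_step \<Omega> (fe r) (fe l) \<gamma> \<epsilon> \<tau> \<phi>\<^sub>0 (Pr \<mu>) \<mu> \<phi> \<longleftrightarrow> reduced \<mu> \<phi>"
    proof -
      have "1 / \<tau> * a + \<epsilon> * b + c = 0 \<longleftrightarrow> a + \<tau> * (\<epsilon> * b + c) = 0" for a b c
        using \<tau> by (simp add: field_simps)
      then show ?thesis
        unfolding scheme_step_iff[OF \<phi>\<^sub>0 Pr_fe[OF \<mu>] \<mu> \<phi>] G_def[symmetric] F_def[symmetric]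
          reduced_def B_def
        using F_orth[OF \<mu>] transport[OF \<mu>] \<mu> \<phi> by (auto simp del: minus_apply)
    qed
    moreover have "Pr \<mu> \<in> fe l \<inter> L2_zero_mean \<Omega>" using Pr[OF \<mu>] by (simp add: is_pressure_def)
    ultimately show ?thesis using \<mu> \<phi> by blast
  qed (auto simp: reduced_def)
  show ?thesis
  proof (rule ex1I[of _ "(Pr \<mu>, \<mu>, \<phi>)"])
    show "(Pr \<mu>, \<mu>, \<phi>) \<in> (fe l \<inter> L2_zero_mean \<Omega>) \<times> fe r \<times> fe r \<and>
        (case (Pr \<mu>, \<mu>, \<phi>) of (p, \<mu>, \<phi>) \<Rightarrow> scheme_step \<Omega> (fe r) (fe l) \<gamma> \<epsilon> \<tau> \<phi>\<^sub>0 p \<mu> \<phi>)"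
      using iff[of "Pr \<mu>" \<mu> \<phi>] red by simp
  next
    fix u assume u: "u \<in> (fe l \<inter> L2_zero_mean \<Omega>) \<times> fe r \<times> fe r \<and>
        (case u of (p, \<mu>, \<phi>) \<Rightarrow> scheme_step \<Omega> (fe r) (fe l) \<gamma> \<epsilon> \<tau> \<phi>\<^sub>0 p \<mu> \<phi>)"
    obtain p' \<mu>' \<phi>' where u_eq: "u = (p', \<mu>', \<phi>')" by (cases u)
    then have "p' = Pr \<mu>' \<and> reduced \<mu>' \<phi>'" using u iff[of p' \<mu>' \<phi>'] by simp
    then show "u = (Pr \<mu>, \<mu>, \<phi>)" using uniq u_eq by blast
  qed
qed

end

theorem theorem3p4:
  fixes \<Omega> :: "(real ^ 'n) set" and \<T> :: "(real ^ 'n) set set"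
    and \<gamma> T \<tau> h \<rho> \<epsilon> :: real and M r l :: nat
    and V W W0 :: "(real ^ 'n \<Rightarrow> real) set"
  assumes "CARD('n) \<in> {2, 3}"
    and "polytopal_domain \<Omega>"
    and "\<gamma> > 0" and "T > 0" and "M \<ge> 1" and "\<tau> = T / real M"
    and "simplicial_mesh \<Omega> \<T>" and "\<rho> > 0" and "quasi_uniform \<rho> \<T>"
    and "h = mesh_size \<T>" and "h \<in> {0<..<1}"
    and "r \<ge> 1" and "l \<ge> 1"
    and "V = fe_space \<Omega> \<T> r" and "W = fe_space \<Omega> \<T> l" and "W0 = W \<inter> L2_zero_mean \<Omega>"
    and "\<epsilon> > 0"
  shows "\<forall>m\<in>{1..M}. \<forall>\<phi>\<^sub>0\<in>V.
           \<exists>!u. u \<in> W0 \<times> V \<times> V \<and>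
             (case u of (p, \<mu>, \<phi>) \<Rightarrow> scheme_step \<Omega> V W \<gamma> \<epsilon> \<tau> \<phi>\<^sub>0 p \<mu> \<phi>)"
proof (intro ballI)
  fix \<phi>\<^sub>0 assume "\<phi>\<^sub>0 \<in> V"
  interpret mesh \<Omega> \<T> by unfold_locales fact+
  have "0 < \<tau>" using assms by simp
  then show "\<exists>!u. u \<in> W0 \<times> V \<times> V \<and>
      (case u of (p, \<mu>, \<phi>) \<Rightarrow> scheme_step \<Omega> V W \<gamma> \<epsilon> \<tau> \<phi>\<^sub>0 p \<mu> \<phi>)"
    using scheme_step_unique_solvability[of \<phi>\<^sub>0 r \<gamma> \<epsilon> \<tau> l] \<open>\<phi>\<^sub>0 \<in> V\<close> assms by simp
qed

end
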